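(* Let an endpoint-local monotone rule run on a finite simple graph $G=(V,E)$ with $N=|V|\ge2$ and $m=|E|\ge1$, from an arbitrary initial law. Let $d$ be a metric or pseudometric on $V$, let $B(v,R)=\{w\in V:d(v,w)\le R\}$ and $V_d(R)=\max_{v\in V}|B(v,R)|$, and fix a permutation $\psi$ of $V$. Let $0\le T\le t$ and $M\ge1$. For $0\le s\le T$ let $R(s)>0$ satisfy $$d(i,\psi(i))\ge 2R(s)\qquad\text{for every } i\in V,$$ and let $q(s)$ be such that, uniformly over all starting profiles, the Palm-initialized tag satisfies $$\mathbb{P}\bigl(d(J_s,J_0)\ge R(s)\bigr)\le q(s).$$ Put $$p=\mathbb{P}\bigl(\operatorname{Gap}(X_t)>M-1\bigr).$$ Then $$M^2\ge\frac mN\int_0^T\frac{[1-p-2q(s)]_+^2}{V_d(R(s))}\,ds .$$ In particular, if $p\le 1/8$ and $q(s)\le1/8$ for all $s\in[0,T]$, then $$M^2\ge\frac{m}{4N}\int_0^T\frac{ds}{V_d(R(s))}.$$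
   Context: Load vectors (profiles) are elements $x\in\mathbb{Z}^V$; $e_w$ is the standard basis vector at $w$; $\operatorname{Gap}(x)=\max_v x_v-\min_v x_v$; $[a]_+=\max\{a,0\}$. An endpoint-local monotone rule on $G$ is given by, for each edge $e\in E$, a fixed orientation $(u,v)$ of $e$ and a nonincreasing function $p_e:\mathbb{Z}\to[0,1]$ (the functions may differ between edges; constants allowed). The edges ring according to independent rate-one Poisson processes. When $e$ with orientation $(u,v)$ rings and the current load vector is $x$, a fresh independent $U$ uniform on $(0,1)$ is drawn, and one ball is added to $u$ if $U\le p_e(x_u-x_v)$ and to $v$ otherwise. $X_t$ is the load vector at time $t$; its initial law is an arbitrary law on $\mathbb{Z}^V$, with $X_0$ independent of the future clocks and marks. $\lambda_w(x)$ denotes the total rate at which vertex $w$ receives a ball in profile $x$; $\sum_w\lambda_w(x)=m$. Tag: run two copies of the process from $x$ and $x+e_v$ with the same clocks and the same marks $U$. At every time their difference (second minus first) is $e_{J_t}$ for a single vertex $J_t$, called the tag, with $J_0=v$. The tag is Palm-initialized at starting profile $x$ if $J_0$ is random, independent of the future clocks and marks, with $\mathbb{P}(J_0=w)=\lambda_w(x)/m$ for $w\in V$. *)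

theory Defs
  imports "HOL-Probability.Probability"
begin

section \<open>Load vectors and endpoint-local monotone rules\<close>

text \<open>
  The vertex set is the finite type \<open>'v\<close>, so a load vector is a function \<open>'v \<Rightarrow> int\<close>.
  Edges are two-element sets of vertices; \<open>ori e = (u, v)\<close> is the fixed orientation of the
  edge \<open>e\<close>, and \<open>thr e\<close> is its threshold function (written \<open>p\<^sub>e\<close> in the mathematics).
\<close>

definition simple_graph :: "'v::finite set set \<Rightarrow> bool" where
  "simple_graph E \<longleftrightarrow> (\<forall>e\<in>E. card e = 2)"

definition endpoint_local_monotone_rule ::
  "'v::finite set set \<Rightarrow> ('v set \<Rightarrow> 'v \<times> 'v) \<Rightarrow> ('v set \<Rightarrow> int \<Rightarrow> real) \<Rightarrow> bool" where
  "endpoint_local_monotone_rule E ori thr \<longleftrightarrow>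
     (\<forall>e\<in>E. e = {fst (ori e), snd (ori e)} \<and> antimono (thr e) \<and> range (thr e) \<subseteq> {0..1})"

definition gap :: "('v::finite \<Rightarrow> int) \<Rightarrow> int" where
  "gap x = Max (range x) - Min (range x)"

text \<open>\<open>x + e\<^sub>w\<close>\<close>
definition add_ball :: "('v \<Rightarrow> int) \<Rightarrow> 'v \<Rightarrow> 'v \<Rightarrow> int" where
  "add_ball x w = x(w := x w + 1)"

text \<open>The endpoint of \<open>e\<close> that gets the ball when \<open>e\<close> rings in profile \<open>x\<close> with mark \<open>U\<close>.\<close>
definition receiver ::
  "('v set \<Rightarrow> 'v \<times> 'v) \<Rightarrow> ('v set \<Rightarrow> int \<Rightarrow> real) \<Rightarrow> ('v \<Rightarrow> int) \<Rightarrow> 'v set \<Rightarrow> real \<Rightarrow> 'v" where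
  "receiver ori thr x e U =
     (case ori e of (u, v) \<Rightarrow> if U \<le> thr e (x u - x v) then u else v)"


section \<open>Clocks and marks\<close>

abbreviation mark_law :: "real measure" where
  "mark_law \<equiv> uniform_measure lborel {0<..<1}"

text \<open>
  A sample point \<open>\<omega>\<close> assigns to each pair \<open>(e, k)\<close> the waiting time between the rings number
  \<open>k - 1\<close> and \<open>k\<close> of the edge \<open>e\<close> (counting from \<open>0\<close>; for \<open>k = 0\<close>, the time of the first ring)
  together with the mark used at ring \<open>k\<close>. The waiting times are independent standard
  exponentials, so the rings of each edge form a rate-one Poisson process, independently over
  the edges and independently of the marks.
\<close>
definition noise :: "'v::finite set set \<Rightarrow> ('v set \<times> nat \<Rightarrow> real \<times> real) measure" where
  "noise E = (\<Pi>\<^sub>M i \<in> E \<times> UNIV.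
      density lborel (\<lambda>x. ennreal (exponential_density 1 x)) \<Otimes>\<^sub>M mark_law)"

definition ring_time :: "('v set \<times> nat \<Rightarrow> real \<times> real) \<Rightarrow> 'v set \<times> nat \<Rightarrow> real" where
  "ring_time \<omega> = (\<lambda>(e, k). \<Sum>j\<le>k. fst (\<omega> (e, j)))"

text \<open>
  All rings up to time \<open>t\<close>, in chronological order. Almost surely they are finitely many and
  have distinct times; on the exceptional null set the list is empty.
\<close>
definition rings ::
  "'v::finite set set \<Rightarrow> real \<Rightarrow> ('v set \<times> nat \<Rightarrow> real \<times> real) \<Rightarrow> ('v set \<times> nat) list" where
  "rings E t \<omega> =
     (let A = {i \<in> E \<times> UNIV. ring_time \<omega> i \<le> t}
      in if finite A \<and> inj_on (ring_time \<omega>) A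
         then sorted_key_list_of_set (ring_time \<omega>) A else [])"


section \<open>The process and the tag\<close>

text \<open>The load vector at time \<open>t\<close>, started from the profile \<open>x\<close> and driven by \<open>\<omega>\<close>.\<close>
definition load ::
  "'v::finite set set \<Rightarrow> ('v set \<Rightarrow> 'v \<times> 'v) \<Rightarrow> ('v set \<Rightarrow> int \<Rightarrow> real) \<Rightarrow> real
    \<Rightarrow> ('v \<Rightarrow> int) \<Rightarrow> ('v set \<times> nat \<Rightarrow> real \<times> real) \<Rightarrow> 'v \<Rightarrow> int" where
  "load E ori thr t x \<omega> =
     foldl (\<lambda>y i. add_ball y (receiver ori thr y (fst i) (snd (\<omega> i)))) x (rings E t \<omega>)"

text \<open>
  Joint law of the initial profile and the driving noise. Since \<open>'v\<close> is finite there are only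
  countably many profiles, so every law of the initial profile is given by a \<open>pmf\<close>.
\<close>
definition process_space ::
  "'v::finite set set \<Rightarrow> ('v \<Rightarrow> int) pmf
    \<Rightarrow> (('v \<Rightarrow> int) \<times> ('v set \<times> nat \<Rightarrow> real \<times> real)) measure" where
  "process_space E init = measure_pmf init \<Otimes>\<^sub>M noise E"

definition tag ::
  "'v::finite set set \<Rightarrow> ('v set \<Rightarrow> 'v \<times> 'v) \<Rightarrow> ('v set \<Rightarrow> int \<Rightarrow> real) \<Rightarrow> real
    \<Rightarrow> ('v \<Rightarrow> int) \<Rightarrow> 'v \<Rightarrow> ('v set \<times> nat \<Rightarrow> real \<times> real) \<Rightarrow> 'v" where
  "tag E ori thr t x v \<omega> =
     (THE w. load E ori thr t (add_ball x v) \<omega> = add_ball (load E ori thr t x \<omega>) w)"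

text \<open>
  The rate \<open>\<lambda>\<^sub>w(x)\<close>: each edge rings at rate one, and a ring of \<open>e\<close> sends its ball to \<open>w\<close> with
  the probability given by the law of the mark.
\<close>
definition rate ::
  "'v::finite set set \<Rightarrow> ('v set \<Rightarrow> 'v \<times> 'v) \<Rightarrow> ('v set \<Rightarrow> int \<Rightarrow> real)
    \<Rightarrow> ('v \<Rightarrow> int) \<Rightarrow> 'v \<Rightarrow> real" where
  "rate E ori thr x w = (\<Sum>e\<in>E. \<P>(U in mark_law. receiver ori thr x e U = w))"

definition palm_law ::
  "'v::finite set set \<Rightarrow> ('v set \<Rightarrow> 'v \<times> 'v) \<Rightarrow> ('v set \<Rightarrow> int \<Rightarrow> real)
    \<Rightarrow> ('v \<Rightarrow> int) \<Rightarrow> 'v measure" where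
  "palm_law E ori thr x =
     density (count_space UNIV) (\<lambda>w. ennreal (rate E ori thr x w / real (card E)))"

text \<open>Joint law of the Palm-initialized \<open>J\<^sub>0\<close> and the driving noise.\<close>
definition palm_space ::
  "'v::finite set set \<Rightarrow> ('v set \<Rightarrow> 'v \<times> 'v) \<Rightarrow> ('v set \<Rightarrow> int \<Rightarrow> real)
    \<Rightarrow> ('v \<Rightarrow> int) \<Rightarrow> ('v \<times> ('v set \<times> nat \<Rightarrow> real \<times> real)) measure" where
  "palm_space E ori thr x = palm_law E ori thr x \<Otimes>\<^sub>M noise E"


section \<open>Pseudometric balls\<close>

definition pseudometric :: "('v \<Rightarrow> 'v \<Rightarrow> real) \<Rightarrow> bool" where
  "pseudometric d \<longleftrightarrow>
     (\<forall>x y. 0 \<le> d x y) \<and> (\<forall>x. d x x = 0) \<and> (\<forall>x y. d x y = d y x) \<and>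
     (\<forall>x y z. d x z \<le> d x y + d y z)"

definition pball :: "('v \<Rightarrow> 'v \<Rightarrow> real) \<Rightarrow> 'v \<Rightarrow> real \<Rightarrow> 'v set" where
  "pball d v r = {w. d v w \<le> r}"

definition max_ball_card :: "('v::finite \<Rightarrow> 'v \<Rightarrow> real) \<Rightarrow> real \<Rightarrow> nat" where
  "max_ball_card d r = Max (range (\<lambda>v. card (pball d v r)))"


section \<open>Well-definedness\<close>

lemma add_ball_inject: "add_ball x v = add_ball x w \<longleftrightarrow> v = w"
proof
  assume "add_ball x v = add_ball x w"
  then have "add_ball x v v = add_ball x w v" by simp
  then show "v = w" by (simp add: add_ball_def split: if_splits)
qed simp

lemma receiver_coupling:
  assumes "endpoint_local_monotone_rule E ori thr" and "simple_graph E" and "e \<in> E"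
  shows "\<exists>w. add_ball (add_ball x v) (receiver ori thr (add_ball x v) e U) =
             add_ball (add_ball x (receiver ori thr x e U)) w"
proof -
  obtain a b where ab: "ori e = (a, b)" by fastforce
  have e: "e = {a, b}" and mono: "antimono (thr e)"
    using assms(1,3) ab by (auto simp: endpoint_local_monotone_rule_def)
  have ne: "a \<noteq> b"
    using assms(2,3) e by (auto simp: simple_graph_def)
  have le: "thr e j \<le> thr e i" if "i \<le> j" for i j
    using mono that by (simp add: antimono_def)
  have comm: "add_ball (add_ball x y) z = add_ball (add_ball x z) y" for y z :: 'a
    by (auto simp: add_ball_def fun_eq_iff)
  show ?thesis
  proof (cases "receiver ori thr (add_ball x v) e U = receiver ori thr x e U")
    case True
    then show ?thesis using comm by metis
  next
    case False
    have "receiver ori thr x e U = v"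
    proof (cases "v = a")
      case True
      then show ?thesis
        using False ab ne le[of "x a - x b" "x a + 1 - x b"]
        by (simp add: receiver_def add_ball_def split: if_splits)
    next
      case v: False
      show ?thesis
      proof (cases "v = b")
        case True
        then show ?thesis
          using False ab ne le[of "x a - (x b + 1)" "x a - x b"]
          by (simp add: receiver_def add_ball_def split: if_splits)
      next
        case False
        then show ?thesis
          using v ab \<open>receiver ori thr (add_ball x v) e U \<noteq> receiver ori thr x e U\<close>
          by (simp add: receiver_def add_ball_def)
      qed
    qed
    then show ?thesis by metis
  qed
qed

text \<open>
  Interpretations of \<^locale>\<open>folding_insort_key\<close> speak about the constant of the locale
  \<^locale>\<open>linorder\<close>; this identifies it with the overloaded one.
\<close>
lemma linorder_sorted_key_list_of_set:
  "linorder.sorted_key_list_of_set (\<le>) f A =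
   sorted_key_list_of_set (f :: 'b \<Rightarrow> 'a::linorder) A"
proof -
  have "linorder.insort_key (\<le>) f x xs = insort_key f x xs" for x xs
    by (induction xs) (simp_all add: linorder.insort_key.simps[OF linorder_axioms])
  then have "linorder.insort_key (\<le>) f = insort_key f"
    by (simp add: fun_eq_iff)
  then show ?thesis
    by (simp add: linorder.sorted_key_list_of_set_def[OF linorder_axioms]
        sorted_key_list_of_set_def)
qed

lemma set_rings: "set (rings E t \<omega>) \<subseteq> E \<times> UNIV"
proof (cases "finite {i \<in> E \<times> UNIV. ring_time \<omega> i \<le> t} \<and>
              inj_on (ring_time \<omega>) {i \<in> E \<times> UNIV. ring_time \<omega> i \<le> t}")
  case True
  then interpret K: folding_insort_key "(\<le>)" "(<)"
      "{i \<in> E \<times> UNIV. ring_time \<omega> i \<le> t}" "ring_time \<omega>"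
    by unfold_locales auto
  have "set (rings E t \<omega>) = {i \<in> E \<times> UNIV. ring_time \<omega> i \<le> t}"
    using True K.set_sorted_key_list_of_set[OF subset_refl]
    unfolding linorder_sorted_key_list_of_set by (simp add: rings_def Let_def)
  then show ?thesis by blast
qed (auto simp: rings_def Let_def)

text \<open>The two coupled copies always differ by exactly one ball, so \<^const>\<open>tag\<close> is well defined.\<close>
lemma tag_unique:
  assumes rule: "endpoint_local_monotone_rule E ori thr" and graph: "simple_graph E"
  shows "\<exists>!w. load E ori thr t (add_ball x v) \<omega> = add_ball (load E ori thr t x \<omega>) w"
proof -
  define step where "step = (\<lambda>y i. add_ball y (receiver ori thr y (fst i) (snd (\<omega> i))))"
  have *: "\<exists>w. foldl step (add_ball x v) is = add_ball (foldl step x is) w"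
    if "fst ` set is \<subseteq> E" for "is"
    using that
  proof (induction "is" arbitrary: x v)
    case (Cons i "is")
    then obtain w where "step (add_ball x v) i = add_ball (step x i) w"
      using receiver_coupling[OF rule graph, of "fst i" x v "snd (\<omega> i)"]
      by (auto simp: step_def)
    then show ?case using Cons by simp
  qed auto
  have "fst ` set (rings E t \<omega>) \<subseteq> E" using set_rings[of E t \<omega>] by auto
  from *[OF this] obtain w
    where "load E ori thr t (add_ball x v) \<omega> = add_ball (load E ori thr t x \<omega>) w"
    by (auto simp: load_def step_def)
  then show ?thesis by (auto simp: add_ball_inject)
qed

lemma prob_space_noise: "prob_space (noise E)"
proof -
  interpret W: prob_space "density lborel (\<lambda>x. ennreal (exponential_density 1 x))"
    by (rule prob_space_exponential_density) simp
  interpret U: prob_space mark_law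
    by (rule prob_space_uniform_measure) auto
  interpret pair_prob_space "density lborel (\<lambda>x. ennreal (exponential_density 1 x))" mark_law ..
  show ?thesis
    unfolding noise_def by (rule prob_space_PiM) (rule prob_space_axioms)
qed

lemma rate_eq:
  assumes rule: "endpoint_local_monotone_rule E ori thr" and graph: "simple_graph E"
  shows "rate E ori thr x w =
    (\<Sum>e\<in>E. case ori e of (u, v) \<Rightarrow>
       if w = u then thr e (x u - x v) else if w = v then 1 - thr e (x u - x v) else 0)"
  unfolding rate_def
proof (rule sum.cong[OF refl])
  fix e assume e: "e \<in> E"
  obtain u v where uv: "ori e = (u, v)" by fastforce
  define c where "c = thr e (x u - x v)"
  have c: "0 \<le> c" "c \<le> 1" and "e = {u, v}"
    using rule e uv by (auto simp: endpoint_local_monotone_rule_def c_def image_subset_iff)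
  then have ne: "u \<noteq> v"
    using graph e by (auto simp: simple_graph_def)
  interpret U: prob_space mark_law
    by (rule prob_space_uniform_measure) auto
  have "measure mark_law {U. U \<le> c} = measure lborel ({0<..<1} \<inter> {..c})"
    by (subst measure_uniform_measure) (auto simp: atMost_def)
  also have "\<dots> = c"
  proof (cases "c = 1")
    case True
    then have "{0<..<1} \<inter> {..c} = {0<..<1}" by auto
    then show ?thesis using True by simp
  next
    case False
    then have "{0<..<1} \<inter> {..c} = {0<..c}" using c by auto
    then show ?thesis using c by simp
  qed
  finally have le: "measure mark_law {U. U \<le> c} = c" .
  have "measure mark_law (space mark_law - {U. U \<le> c}) = 1 - c"
    using U.prob_compl[of "{U. U \<le> c}"] le by simp
  moreover have "space mark_law - {U. U \<le> c} = {U. \<not> U \<le> c}" by auto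
  ultimately have gt: "measure mark_law {U. \<not> U \<le> c} = 1 - c" by simp
  have "{U \<in> space mark_law. receiver ori thr x e U = w} =
      (if w = u then {U. U \<le> c} else if w = v then {U. \<not> U \<le> c} else {})"
    using ne by (auto simp: receiver_def uv c_def)
  then show "\<P>(U in mark_law. receiver ori thr x e U = w) =
      (case ori e of (u, v) \<Rightarrow>
        if w = u then thr e (x u - x v) else if w = v then 1 - thr e (x u - x v) else 0)"
    using le gt ne by (simp add: uv c_def)
qed

lemma sum_rate:
  assumes rule: "endpoint_local_monotone_rule E ori thr" and graph: "simple_graph E"
  shows "(\<Sum>w\<in>UNIV. rate E ori thr x w) = real (card E)"
proof -
  have "(\<Sum>w\<in>UNIV. case ori e of (u, v) \<Rightarrow>
       if w = u then thr e (x u - x v) else if w = v then 1 - thr e (x u - x v) else 0) = 1"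
    if e: "e \<in> E" for e
  proof -
    obtain u v where uv: "ori e = (u, v)" by fastforce
    then have "e = {u, v}"
      using rule e by (auto simp: endpoint_local_monotone_rule_def)
    then have ne: "u \<noteq> v"
      using graph e by (auto simp: simple_graph_def)
    let ?c = "thr e (x u - x v)"
    have "(\<Sum>w\<in>UNIV. if w = u then ?c else if w = v then 1 - ?c else 0) =
        (\<Sum>w\<in>UNIV. (if w = u then ?c else 0) + (if w = v then 1 - ?c else 0))"
      using ne by (intro sum.cong) auto
    also have "\<dots> = 1" by (simp add: sum.distrib)
    finally show ?thesis by (simp add: uv)
  qed
  then show ?thesis
    unfolding rate_eq[OF rule graph] by (subst sum.swap) simp
qed

end

(* Fix i and let f_i(x) be x_i - x_{psi(i)} truncated to [-M, M]. Write P_r f_i(x) for the mean of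
   f_i after time r from x. The energy G(r) = sum_i E (P_r f_i (X_{t-r}))^2 is at most N M^2 at
   r = 0, and its loss over [r, r + h] is the mean variance of P_r f_i under the kernel P_h. Keeping
   only the events of zero and one ring, this is at least about
   m h E sum_w (rate_w / m) sum_i (P_r f_i(x + e_w) - P_r f_i(x))^2.
   Coupling x and x + e_w, the increments in the inner sum are those of f_i when one ball is added at
   the tag J. If the gap is at most M - 1 and d(J, w) < R then, over the ball B(w, R), the tag itself
   contributes 1 and its partner contributes nothing, being at distance at least 2R from it. By
   Cauchy-Schwarz and Jensen the loss rate at r is at least m [1 - p - 2 q(r)]_+^2 / V_d(R(r)), and
   one integrates. *)
theory Submission
  imports Defs
begin

section \<open>Regeneration of the noise at the first ring\<close>

text \<open>The process is given by sample paths, whereas the energy argument wants a semigroup; the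
  coupling in turn is invisible to the semigroup, since it needs two copies on one noise. So the law
  of the load is identified with \<open>trans t\<close>, a Poisson number of steps of the embedded
  chain, where the semigroup law is elementary. Palm initialization fits because it is the law of
  the next receiver: in the one-ring term of the variance the added ball starts a Palm-initialized
  tag. The level \<open>M - 1\<close> leaves room for one more ball before truncation at
  \<open>M\<close> acts. The factor 2 at \<open>q\<close> counts two losses when the tag is far: its
  own unit may be missed and its partner's decrement may be felt. A step of length \<open>h\<close>
  sees the gap at time \<open>t - h\<close> instead of \<open>t\<close>; the correction vanishes
  with \<open>h\<close>. Nothing relates \<open>R\<close> and \<open>q\<close> at different times,
  so the loss rate has no regularity beyond integrability and the energy is not differentiated.
  Also, the integrability of neither integrand in the conclusion is deduced from the other's, so
  both bounds come from one lemma about integrable minorants.\<close>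

lemma nn_integral_PiM_split_coord:
  assumes "\<And>j. j \<in> I \<Longrightarrow> prob_space (M j)" "i \<in> I" and f: "f \<in> borel_measurable (PiM I M)"
  shows "(\<integral>\<^sup>+X. f X \<partial>PiM I M) = (\<integral>\<^sup>+x. \<integral>\<^sup>+X. f (X(i := x)) \<partial>PiM (I - {i}) M \<partial>M i)"
    and "(\<integral>\<^sup>+X. f X \<partial>PiM I M) = (\<integral>\<^sup>+X. \<integral>\<^sup>+x. f (X(i := x)) \<partial>M i \<partial>PiM (I - {i}) M)"
proof -
  interpret Mi: prob_space "M i" using assms by auto
  interpret Q: prob_space "PiM (I - {i}) M" using assms by (intro prob_space_PiM) auto
  interpret pair_sigma_finite "M i" "PiM (I - {i}) M" ..
  have I: "insert i (I - {i}) = I" using assms(2) by auto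
  have meas: "(\<lambda>(x, Y). Y(i := x)) \<in> M i \<Otimes>\<^sub>M PiM (I - {i}) M \<rightarrow>\<^sub>M PiM I M"
    using measurable_add_dim[of i "I - {i}" M] measurable_compose[OF measurable_pair_swap']
    unfolding I by (force simp: case_prod_beta)
  have D: "distr (M i \<Otimes>\<^sub>M PiM (I - {i}) M) (PiM I M) (\<lambda>(x, Y). Y(i := x)) = PiM I M"
    using distr_pair_PiM_eq_PiM[of "I - {i}" M i] assms unfolding I by auto
  have fm: "(\<lambda>z. f (case z of (x, Y) \<Rightarrow> Y(i := x))) \<in> borel_measurable (M i \<Otimes>\<^sub>M PiM (I - {i}) M)"
    using measurable_compose[OF meas f] .
  have *: "(\<integral>\<^sup>+X. f X \<partial>PiM I M) =
      (\<integral>\<^sup>+z. f (case z of (x, Y) \<Rightarrow> Y(i := x)) \<partial>(M i \<Otimes>\<^sub>M PiM (I - {i}) M))"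
    by (subst D[symmetric], subst nn_integral_distr[OF meas]) (auto simp: f)
  show "(\<integral>\<^sup>+X. f X \<partial>PiM I M) = (\<integral>\<^sup>+x. \<integral>\<^sup>+X. f (X(i := x)) \<partial>PiM (I - {i}) M \<partial>M i)"
    using Q.nn_integral_fst[OF fm] * by simp
  show "(\<integral>\<^sup>+X. f X \<partial>PiM I M) = (\<integral>\<^sup>+X. \<integral>\<^sup>+x. f (X(i := x)) \<partial>M i \<partial>PiM (I - {i}) M)"
    using nn_integral_snd[OF fm] * by simp
qed

text \<open>Memorylessness of several clocks at once, in abstract form: in the applications
  \<open>a\<close> says that a clock has not rung yet, \<open>\<tau>\<close> resets it, and each
  clock in \<open>F\<close> contributes one factor \<open>c\<close>. With \<open>\<Psi>\<close>
  arbitrary, the induction absorbs the weight and the shift of one coordinate into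
  \<open>\<Psi>'\<close>.\<close>

lemma nn_integral_PiM_transform_coords:
  fixes M :: "'b measure" and a :: "'b \<Rightarrow> ennreal" and I :: "'i set"
  assumes M: "prob_space M"
    and a[measurable]: "a \<in> borel_measurable M" and \<tau>[measurable]: "\<tau> \<in> M \<rightarrow>\<^sub>M M"
    and single: "\<And>\<phi>. \<phi> \<in> borel_measurable M \<Longrightarrow> (\<integral>\<^sup>+z. a z * \<phi> (\<tau> z) \<partial>M) = c * (\<integral>\<^sup>+z. \<phi> z \<partial>M)"
    and "finite F" "F \<subseteq> I" and "\<Psi> \<in> borel_measurable (PiM I (\<lambda>_. M))"
  shows "(\<integral>\<^sup>+X. (\<Prod>i\<in>F. a (X i)) * \<Psi> (\<lambda>i\<in>I. if i \<in> F then \<tau> (X i) else X i) \<partial>PiM I (\<lambda>_. M)) =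
    c ^ card F * (\<integral>\<^sup>+X. \<Psi> X \<partial>PiM I (\<lambda>_. M))"
  using assms(5-)
proof (induction F arbitrary: \<Psi> rule: finite_induct)
  case empty
  have "(\<integral>\<^sup>+X. \<Psi> (restrict X I) \<partial>PiM I (\<lambda>_. M)) = (\<integral>\<^sup>+X. \<Psi> X \<partial>PiM I (\<lambda>_. M))"
    by (intro nn_integral_cong) (auto simp: space_PiM PiE_restrict)
  then show ?case by (simp add: restrict_def)
next
  case (insert j F)
  note [measurable] = insert.prems(2)
  have j: "j \<in> I" and F: "F \<subseteq> I" using insert.prems by auto
  have upd[measurable]: "(\<lambda>X. X(j := \<tau> (X j))) \<in> PiM I (\<lambda>_. M) \<rightarrow>\<^sub>M PiM I (\<lambda>_. M)"
    using j by (intro measurable_fun_upd[where J=I]) auto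
  have comp[measurable]: "(\<lambda>X. X j) \<in> PiM I (\<lambda>_. M) \<rightarrow>\<^sub>M M" using j by simp
  define \<Psi>' where "\<Psi>' = (\<lambda>X. a (X j) * \<Psi> (X(j := \<tau> (X j))))"
  have \<Psi>'[measurable]: "\<Psi>' \<in> borel_measurable (PiM I (\<lambda>_. M))" unfolding \<Psi>'_def by measurable
  have "(\<Prod>i\<in>insert j F. a (X i)) * \<Psi> (\<lambda>i\<in>I. if i \<in> insert j F then \<tau> (X i) else X i) =
      (\<Prod>i\<in>F. a (X i)) * \<Psi>' (\<lambda>i\<in>I. if i \<in> F then \<tau> (X i) else X i)" for X
  proof -
    have "(\<lambda>i\<in>I. if i \<in> insert j F then \<tau> (X i) else X i) =
       (\<lambda>i\<in>I. if i \<in> F then \<tau> (X i) else X i)(j := \<tau> (X j))"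
      using j by (auto simp: fun_eq_iff)
    then show ?thesis using insert.hyps j by (simp add: \<Psi>'_def ac_simps)
  qed
  then have "(\<integral>\<^sup>+X. (\<Prod>i\<in>insert j F. a (X i)) *
        \<Psi> (\<lambda>i\<in>I. if i \<in> insert j F then \<tau> (X i) else X i) \<partial>PiM I (\<lambda>_. M)) =
      c ^ card F * (\<integral>\<^sup>+X. \<Psi>' X \<partial>PiM I (\<lambda>_. M))"
    by (simp only: insert.IH[OF F \<Psi>'])
  also have "(\<integral>\<^sup>+X. \<Psi>' X \<partial>PiM I (\<lambda>_. M)) = c * (\<integral>\<^sup>+X. \<Psi> X \<partial>PiM I (\<lambda>_. M))"
  proof -
    have upd2: "(\<lambda>x. X(j := x)) \<in> M \<rightarrow>\<^sub>M PiM I (\<lambda>_. M)"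
      if "X \<in> space (PiM (I - {j}) (\<lambda>_. M))" for X
      using that j by (intro measurable_fun_upd[where J="I - {j}"]) auto
    have "(\<integral>\<^sup>+X. \<Psi>' X \<partial>PiM I (\<lambda>_. M)) =
        (\<integral>\<^sup>+X. \<integral>\<^sup>+x. \<Psi>' (X(j := x)) \<partial>M \<partial>PiM (I - {j}) (\<lambda>_. M))"
      using M j by (subst nn_integral_PiM_split_coord(2)[where i=j]) auto
    also have "\<dots> = (\<integral>\<^sup>+X. c * \<integral>\<^sup>+x. \<Psi> (X(j := x)) \<partial>M \<partial>PiM (I - {j}) (\<lambda>_. M))"
    proof (intro nn_integral_cong)
      fix X assume X: "X \<in> space (PiM (I - {j}) (\<lambda>_. M))"
      show "(\<integral>\<^sup>+x. \<Psi>' (X(j := x)) \<partial>M) = c * \<integral>\<^sup>+x. \<Psi> (X(j := x)) \<partial>M"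
        using single[of "\<lambda>x. \<Psi> (X(j := x))"] measurable_compose[OF upd2[OF X] insert.prems(2)]
        by (simp add: \<Psi>'_def)
    qed
    also have "\<dots> = c * (\<integral>\<^sup>+X. \<integral>\<^sup>+x. \<Psi> (X(j := x)) \<partial>M \<partial>PiM (I - {j}) (\<lambda>_. M))"
    proof (rule nn_integral_cmult)
      interpret prob_space M by fact
      have "(\<lambda>z. (fst z)(j := snd z)) \<in> PiM (I - {j}) (\<lambda>_. M) \<Otimes>\<^sub>M M \<rightarrow>\<^sub>M PiM I (\<lambda>_. M)"
        using j by (intro measurable_fun_upd[where J="I - {j}"]) auto
      from measurable_compose[OF this insert.prems(2)]
      show "(\<lambda>X. \<integral>\<^sup>+x. \<Psi> (X(j := x)) \<partial>M) \<in> borel_measurable (PiM (I - {j}) (\<lambda>_. M))"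
        by (intro borel_measurable_nn_integral) (simp add: case_prod_beta fun_upd_def)
    qed
    also have "\<dots> = c * (\<integral>\<^sup>+X. \<Psi> X \<partial>PiM I (\<lambda>_. M))"
      using M j by (subst (2) nn_integral_PiM_split_coord(2)[where i=j]) auto
    finally show ?thesis .
  qed
  finally show ?case using insert.hyps by (simp add: ac_simps)
qed

section \<open>Memorylessness of a single clock\<close>

abbreviation exp_law :: "real measure" where
  "exp_law \<equiv> density lborel (\<lambda>x. ennreal (exponential_density 1 x))"

lemma nn_integral_exp_shift:
  assumes [measurable]: "\<psi> \<in> borel_measurable borel" and s: "0 \<le> s"
  shows "(\<integral>\<^sup>+w. indicator {s<..} w * \<psi> (w - s) \<partial>exp_law) = ennreal (exp (- s)) * (\<integral>\<^sup>+w. \<psi> w \<partial>exp_law)"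
proof -
  have "(\<integral>\<^sup>+w. indicator {s<..} w * \<psi> (w - s) \<partial>exp_law) =
      (\<integral>\<^sup>+w. ennreal (exponential_density 1 w) * (indicator {s<..} w * \<psi> (w - s)) \<partial>lborel)"
    by (subst nn_integral_density) auto
  also have "\<dots> = (\<integral>\<^sup>+v. ennreal (exponential_density 1 (s + v)) * (indicator {0<..} v * \<psi> v) \<partial>lborel)"
    by (subst nn_integral_real_affine[where c=1 and t=s])
      (auto intro!: nn_integral_cong simp: indicator_def)
  also have "\<dots> = (\<integral>\<^sup>+v. ennreal (exp (- s)) * (ennreal (exponential_density 1 v) * \<psi> v) \<partial>lborel)"
  proof (rule nn_integral_cong_AE)
    \<comment> \<open>The point \<open>v = 0\<close> has to go: there the strict indicator vanishes,
      while the density on the right is \<open>1\<close>.\<close>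
    have "AE v in lborel. v \<noteq> (0::real)" by (rule AE_lborel_singleton)
    then show "AE v in lborel. ennreal (exponential_density 1 (s + v)) * (indicator {0<..} v * \<psi> v) =
        ennreal (exp (- s)) * (ennreal (exponential_density 1 v) * \<psi> v)"
    proof eventually_elim
      case (elim v)
      then show ?case using s
        by (cases "v > 0")
          (auto simp: exponential_density_def indicator_def exp_add exp_diff exp_minus divide_simps
            ennreal_mult'' ennreal_mult[symmetric] mult.assoc[symmetric])
    qed
  qed
  also have "\<dots> = ennreal (exp (- s)) * (\<integral>\<^sup>+w. \<psi> w \<partial>exp_law)"
    by (subst nn_integral_cmult) (auto simp: nn_integral_density)
  finally show ?thesis .
qed

lemma nn_integral_exp_pair_shift:
  assumes U: "prob_space U" "sets U = sets borel"
    and \<phi>: "\<phi> \<in> borel_measurable (exp_law \<Otimes>\<^sub>M U)" and s: "0 \<le> s"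
  shows "(\<integral>\<^sup>+z. indicator {z. s < fst z} z * \<phi> (fst z - s, snd z) \<partial>(exp_law \<Otimes>\<^sub>M U)) =
    ennreal (exp (- s)) * (\<integral>\<^sup>+z. \<phi> z \<partial>(exp_law \<Otimes>\<^sub>M U))"
proof -
  interpret U: prob_space U by fact
  note [measurable_cong] = U(2)
  note [measurable] = \<phi>
  have "(\<integral>\<^sup>+z. indicator {z. s < fst z} z * \<phi> (fst z - s, snd z) \<partial>(exp_law \<Otimes>\<^sub>M U)) =
      (\<integral>\<^sup>+w. \<integral>\<^sup>+u. indicator {s<..} w * \<phi> (w - s, u) \<partial>U \<partial>exp_law)"
    by (subst U.nn_integral_fst[symmetric]) (auto intro!: nn_integral_cong simp: indicator_def)
  also have "\<dots> = (\<integral>\<^sup>+w. indicator {s<..} w * (\<integral>\<^sup>+u. \<phi> (w - s, u) \<partial>U) \<partial>exp_law)"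
    by (intro nn_integral_cong nn_integral_cmult) auto
  also have "\<dots> = ennreal (exp (- s)) * (\<integral>\<^sup>+w. \<integral>\<^sup>+u. \<phi> (w, u) \<partial>U \<partial>exp_law)"
    by (rule nn_integral_exp_shift[OF _ s]) measurable
  finally show ?thesis by (simp add: U.nn_integral_fst)
qed

abbreviation ring_law :: "(real \<times> real) measure" where
  "ring_law \<equiv> exp_law \<Otimes>\<^sub>M mark_law"

lemma prob_space_mark_law: "prob_space mark_law"
  by (rule prob_space_uniform_measure) auto

lemma prob_space_ring_law: "prob_space ring_law"
proof -
  interpret W: prob_space exp_law
    by (rule prob_space_exponential_density) simp
  interpret U: prob_space mark_law by (rule prob_space_mark_law)
  interpret pair_prob_space exp_law mark_law ..
  show ?thesis by unfold_locales
qed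

lemma AE_exp_law_pos: "AE w in exp_law. 0 < w"
proof -
  have "AE v in lborel. v \<noteq> (0::real)" by (rule AE_lborel_singleton)
  then have "AE v in lborel. 0 < ennreal (exponential_density 1 v) \<longrightarrow> 0 < v"
  proof eventually_elim
    case (elim v)
    then show ?case by (simp add: exponential_density_def)
  qed
  then show ?thesis by (subst AE_density) auto
qed

lemma AE_ring_law_pos: "AE z in ring_law. 0 < fst z"
proof -
  interpret U: prob_space mark_law by (rule prob_space_mark_law)
  interpret W: prob_space exp_law by (rule prob_space_exponential_density) simp
  interpret pair_prob_space exp_law mark_law ..
  show ?thesis
  proof (rule AE_pair_measure)
    show "AE x in exp_law. AE y in mark_law. 0 < fst (x, y)"
      using AE_exp_law_pos by simp
  qed measurable
qed

section \<open>Splitting the noise at its first ring\<close>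

definition time_shift :: "real \<Rightarrow> real \<times> real \<Rightarrow> real \<times> real" where
  "time_shift s z = (fst z - s, snd z)"

text \<open>The index of the ring that becomes ring \<open>i\<close> once ring \<open>(e, 0)\<close> has been used up.\<close>
definition next_ring :: "'v set \<Rightarrow> 'v set \<times> nat \<Rightarrow> 'v set \<times> nat" where
  "next_ring e = (\<lambda>(e', k). if e' = e then (e, Suc k) else (e', k))"

text \<open>Strictness makes the first edge unique (\<open>first_ring_unique\<close>); on a tie for
  the earliest ring no edge qualifies.\<close>

definition first_ring :: "'v::finite set set \<Rightarrow> 'v set \<Rightarrow> ('v set \<times> nat \<Rightarrow> real \<times> real) \<Rightarrow> bool" where
  "first_ring E e X \<longleftrightarrow> (\<forall>e'\<in>E - {e}. fst (X (e, 0)) < fst (X (e', 0)))"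

text \<open>The noise stores waiting times rather than ring times, so another edge loses the elapsed
  time only from its waiting time number \<open>0\<close>. The edge \<open>e\<close> drops its ring
  \<open>0\<close> and is renumbered. Marks travel with their rings.\<close>

definition after_ring ::
  "'v::finite set set \<Rightarrow> 'v set \<Rightarrow> ('v set \<times> nat \<Rightarrow> real \<times> real) \<Rightarrow> 'v set \<times> nat \<Rightarrow> real \<times> real" where
  "after_ring E e X = (\<lambda>i\<in>E \<times> UNIV. if i \<in> (E - {e}) \<times> {0}
     then time_shift (fst (X (e, 0))) (X i) else X (next_ring e i))"

lemma measurable_noise_component:
  "i \<in> E \<times> UNIV \<Longrightarrow> f \<in> N \<rightarrow>\<^sub>M noise E \<Longrightarrow> (\<lambda>x. f x i) \<in> N \<rightarrow>\<^sub>M ring_law"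
  unfolding noise_def by (rule measurable_compose[OF _ measurable_component_singleton])

lemma measurable_wait[measurable]:
  assumes "i \<in> E \<times> UNIV" shows "(\<lambda>X. fst (X i)) \<in> borel_measurable (noise E)"
  using measurable_compose[OF measurable_noise_component[OF assms measurable_ident] measurable_fst]
  by simp

lemma measurable_mark[measurable]:
  assumes "i \<in> E \<times> UNIV" shows "(\<lambda>X. snd (X i)) \<in> borel_measurable (noise E)"
  using measurable_compose[OF measurable_noise_component[OF assms measurable_ident] measurable_snd]
  by (simp cong: measurable_cong_sets)

lemma measurable_time_shift2:
  "(\<lambda>z. time_shift (fst z) (snd z)) \<in> borel \<Otimes>\<^sub>M ring_law \<rightarrow>\<^sub>M ring_law"
  unfolding time_shift_def by measurable

lemma measurable_time_shift[measurable]: "time_shift s \<in> ring_law \<rightarrow>\<^sub>M ring_law"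
  unfolding time_shift_def by measurable

lemma measurable_first_ring[measurable]:
  assumes "e \<in> E" shows "Measurable.pred (noise E) (first_ring E e)"
proof -
  have [measurable]: "(\<lambda>X. fst (X (e', 0))) \<in> borel_measurable (noise E)" if "e' \<in> E" for e'
    using that by (intro measurable_wait) auto
  show ?thesis unfolding first_ring_def using assms by measurable
qed

lemma measurable_after_ring[measurable]:
  assumes e: "e \<in> E" shows "after_ring E e \<in> noise E \<rightarrow>\<^sub>M noise E"
proof -
  have "after_ring E e \<in> noise E \<rightarrow>\<^sub>M PiM (E \<times> UNIV) (\<lambda>_. ring_law)"
    unfolding after_ring_def
  proof (rule measurable_restrict)
    fix i :: "'a set \<times> nat" assume i: "i \<in> E \<times> UNIV"
    have wait: "(\<lambda>X. fst (X (e, 0))) \<in> borel_measurable (noise E)"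
      using e by (intro measurable_wait) auto
    have comp: "(\<lambda>X. X (e, 0)) \<in> noise E \<rightarrow>\<^sub>M ring_law" "(\<lambda>X. X i) \<in> noise E \<rightarrow>\<^sub>M ring_law"
      "(\<lambda>X. X (next_ring e i)) \<in> noise E \<rightarrow>\<^sub>M ring_law"
      using i e by (auto intro!: measurable_noise_component simp: next_ring_def split: prod.splits)
    show "(\<lambda>X. if i \<in> (E - {e}) \<times> {0} then time_shift (fst (X (e, 0))) (X i) else X (next_ring e i))
        \<in> noise E \<rightarrow>\<^sub>M ring_law"
      using measurable_compose[OF measurable_Pair[OF _ comp(2)] measurable_time_shift2, of "\<lambda>X. fst (X (e, 0))"]
      by (cases "i \<in> (E - {e}) \<times> {0}") (use comp wait in simp_all)
  qed
  then show ?thesis by (simp add: noise_def)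
qed

lemma AE_noise_pos: "AE X in noise E. \<forall>i\<in>E \<times> UNIV. 0 < fst (X i)"
proof -
  have "AE X in noise E. 0 < fst (X i)" if "i \<in> E \<times> UNIV" for i
    unfolding noise_def using that prob_space_ring_law AE_ring_law_pos by (intro AE_PiM_component) auto
  then show ?thesis by (subst AE_ball_countable) (auto intro: countableI_type)
qed

lemma prod_indicator_ennreal:
  "finite F \<Longrightarrow> (\<Prod>i\<in>F. indicator A (X i) :: ennreal) = indicator {X. \<forall>i\<in>F. X i \<in> A} X"
  by (induction F rule: finite_induct) (auto simp: indicator_def)

text \<open>The memoryless property: the noise after the first ring, at which \<open>e\<close> rings, is fresh.\<close>
lemma nn_integral_noise_first_ring:
  assumes e: "e \<in> E" and \<Psi>: "\<Psi> \<in> borel_measurable (ring_law \<Otimes>\<^sub>M noise E)"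
  shows "(\<integral>\<^sup>+X. indicator {X. first_ring E e X} X * \<Psi> (X (e, 0), after_ring E e X) \<partial>noise E) =
    (\<integral>\<^sup>+z. ennreal (exp (- (fst z))) ^ (card E - 1) * (\<integral>\<^sup>+X. \<Psi> (z, X) \<partial>noise E) \<partial>ring_law)"
proof -
  interpret RL: prob_space ring_law by (rule prob_space_ring_law)
  define I where "I = E \<times> (UNIV::nat set)"
  define i0 where "i0 = (e, 0::nat)"
  define F where "F = (E - {e}) \<times> {0::nat}"
  have N: "noise E = PiM I (\<lambda>_. ring_law)" by (simp add: noise_def I_def)
  have i0: "i0 \<in> I" using e by (simp add: i0_def I_def)
  have F: "finite F" "F \<subseteq> I - {i0}" by (auto simp: F_def I_def i0_def)
  have cF: "card F = card E - 1" using e by (simp add: F_def card_cartesian_product)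
  note [measurable] = \<Psi> measurable_first_ring[OF e] measurable_after_ring[OF e]
  have [measurable]: "(\<lambda>X. X (e, 0)) \<in> noise E \<rightarrow>\<^sub>M ring_law"
    using e by (auto intro!: measurable_noise_component)
  have "(\<integral>\<^sup>+X. indicator {X. first_ring E e X} X * \<Psi> (X (e, 0), after_ring E e X) \<partial>noise E) =
      (\<integral>\<^sup>+z. \<integral>\<^sup>+X. indicator {X. first_ring E e X} (X(i0 := z)) *
         \<Psi> ((X(i0 := z)) (e, 0), after_ring E e (X(i0 := z))) \<partial>PiM (I - {i0}) (\<lambda>_. ring_law) \<partial>ring_law)"
    unfolding N using i0 prob_space_ring_law
    by (intro nn_integral_PiM_split_coord(1)) (auto simp flip: N)
  also have "\<dots> = (\<integral>\<^sup>+z. ennreal (exp (- (fst z))) ^ (card E - 1) * (\<integral>\<^sup>+X. \<Psi> (z, X) \<partial>noise E) \<partial>ring_law)"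
  proof (rule nn_integral_cong_AE)
    show "AE z in ring_law. (\<integral>\<^sup>+X. indicator {X. first_ring E e X} (X(i0 := z)) *
         \<Psi> ((X(i0 := z)) (e, 0), after_ring E e (X(i0 := z))) \<partial>PiM (I - {i0}) (\<lambda>_. ring_law)) =
         ennreal (exp (- (fst z))) ^ (card E - 1) * (\<integral>\<^sup>+X. \<Psi> (z, X) \<partial>noise E)"
      using AE_ring_law_pos AE_space
    proof eventually_elim
      case (elim z)
      define s where "s = fst z"
      have s: "0 \<le> s" using elim by (simp add: s_def)
      have [measurable]: "z \<in> space ring_law" by fact
      \<comment> \<open>\<open>next_ring e\<close> is an injective relabelling of independent,
        identically distributed coordinates, so the coordinates left after removing
        \<open>(e, 0)\<close>, read along it, again have the law of the noise.\<close>
      define re where "re = (\<lambda>Y::'a set \<times> nat \<Rightarrow> real \<times> real. \<lambda>i\<in>I. Y (next_ring e i))"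
      have inj: "inj_on (next_ring e) I" "next_ring e \<in> I \<rightarrow> I - {i0}"
        by (auto simp: next_ring_def I_def i0_def inj_on_def split: if_splits)
      have re_law: "distr (PiM (I - {i0}) (\<lambda>_. ring_law)) (PiM I (\<lambda>_. ring_law)) re = PiM I (\<lambda>_. ring_law)"
        unfolding re_def using prob_space_ring_law inj by (intro distr_PiM_reindex) auto
      have re[measurable]: "re \<in> PiM (I - {i0}) (\<lambda>_. ring_law) \<rightarrow>\<^sub>M noise E"
        unfolding re_def N using inj by (intro measurable_restrict measurable_component_singleton) auto
      have "indicator {X. first_ring E e X} (X(i0 := z)) *
         \<Psi> ((X(i0 := z)) (e, 0), after_ring E e (X(i0 := z))) =
         (\<Prod>i\<in>F. indicator {z. s < fst z} (X i)) *
         \<Psi> (z, re (\<lambda>i\<in>I - {i0}. if i \<in> F then time_shift s (X i) else X i))" for X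
      proof -
        have "first_ring E e (X(i0 := z)) \<longleftrightarrow> (\<forall>i\<in>F. X i \<in> {z. s < fst z})"
          by (auto simp: first_ring_def F_def i0_def s_def)
        moreover have "after_ring E e (X(i0 := z)) =
            re (\<lambda>i\<in>I - {i0}. if i \<in> F then time_shift s (X i) else X i)"
          by (auto simp: after_ring_def re_def F_def i0_def I_def s_def next_ring_def fun_eq_iff)
        ultimately show ?thesis
          using F(1) by (simp add: prod_indicator_ennreal) (simp add: i0_def indicator_def)
      qed
      then have "(\<integral>\<^sup>+X. indicator {X. first_ring E e X} (X(i0 := z)) *
         \<Psi> ((X(i0 := z)) (e, 0), after_ring E e (X(i0 := z))) \<partial>PiM (I - {i0}) (\<lambda>_. ring_law)) =
        (\<integral>\<^sup>+X. (\<Prod>i\<in>F. indicator {z. s < fst z} (X i)) *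
         (\<lambda>Y. \<Psi> (z, re Y)) (\<lambda>i\<in>I - {i0}. if i \<in> F then time_shift s (X i) else X i) \<partial>PiM (I - {i0}) (\<lambda>_. ring_law))"
        by simp
      \<comment> \<open>Each of the \<open>card E - 1\<close> other clocks has to survive until
        \<open>s\<close>, at the price of one factor \<open>exp (- s)\<close>, and is then as good
        as new.\<close>
      also have "\<dots> = ennreal (exp (- s)) ^ card F * (\<integral>\<^sup>+Y. \<Psi> (z, re Y) \<partial>PiM (I - {i0}) (\<lambda>_. ring_law))"
      proof (rule nn_integral_PiM_transform_coords[OF prob_space_ring_law _ _ _ F])
        show "(indicator {z. s < fst z} :: _ \<Rightarrow> ennreal) \<in> borel_measurable ring_law" by measurable
        show "(\<lambda>Y. \<Psi> (z, re Y)) \<in> borel_measurable (PiM (I - {i0}) (\<lambda>_. ring_law))" by measurable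
        show "(\<integral>\<^sup>+y. indicator {z. s < fst z} y * \<phi> (time_shift s y) \<partial>ring_law) =
            ennreal (exp (- s)) * integral\<^sup>N ring_law \<phi>" if "\<phi> \<in> borel_measurable ring_law" for \<phi>
          unfolding time_shift_def using prob_space_mark_law that s
          by (intro nn_integral_exp_pair_shift) auto
      qed measurable
      also have "(\<integral>\<^sup>+Y. \<Psi> (z, re Y) \<partial>PiM (I - {i0}) (\<lambda>_. ring_law)) = (\<integral>\<^sup>+X. \<Psi> (z, X) \<partial>noise E)"
        unfolding N by (subst re_law[symmetric], subst nn_integral_distr) (auto simp flip: N)
      finally show ?case unfolding cF s_def .
    qed
  qed
  finally show ?thesis .
qed

section \<open>Measurability of the rings and the load\<close>

text \<open>Order conditions on ring times replace the sorting function inside \<open>rings\<close>;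
  finiteness, distinctness and order are all carried by the list.\<close>

definition lists_rings ::
  "'v::finite set set \<Rightarrow> real \<Rightarrow> ('v set \<times> nat \<Rightarrow> real \<times> real) \<Rightarrow> ('v set \<times> nat) list \<Rightarrow> bool" where
  "lists_rings E t X l \<longleftrightarrow>
     set l = {i \<in> E \<times> UNIV. ring_time X i \<le> t} \<and> sorted_wrt (<) (map (ring_time X) l)"

lemma lists_rings_imp_rings:
  assumes "lists_rings E t X l" shows "rings E t X = l"
proof -
  let ?A = "{i \<in> E \<times> UNIV. ring_time X i \<le> t}"
  have l: "set l = ?A" "sorted_wrt (<) (map (ring_time X) l)"
    using assms by (auto simp: lists_rings_def)
  then have d: "distinct l" "inj_on (ring_time X) ?A"
    by (auto simp: strict_sorted_iff distinct_map)
  have fin: "finite ?A" using l(1) by (metis List.finite_set)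
  interpret K: folding_insort_key "(\<le>)" "(<)" ?A "ring_time X"
    by unfold_locales (use d in auto)
  have "sorted_key_list_of_set (ring_time X) ?A = l"
    using K.sorted_key_list_of_set_unique[OF subset_refl fin, of l] l d
    unfolding linorder_sorted_key_list_of_set by (simp add: distinct_card[symmetric])
  then show ?thesis using fin d by (simp add: rings_def Let_def)
qed

text \<open>The empty list is excluded because \<open>rings\<close> also returns it as the default
  on its exceptional set, where \<open>lists_rings\<close> fails.\<close>

lemma rings_eq_iff:
  assumes "l \<noteq> []" shows "rings E t X = l \<longleftrightarrow> lists_rings E t X l"
proof
  let ?A = "{i \<in> E \<times> UNIV. ring_time X i \<le> t}"
  assume r: "rings E t X = l"
  then have fin: "finite ?A" and inj: "inj_on (ring_time X) ?A"
    and eq: "sorted_key_list_of_set (ring_time X) ?A = l"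
    using assms by (auto simp: rings_def Let_def split: if_splits)
  interpret K: folding_insort_key "(\<le>)" "(<)" ?A "ring_time X"
    by unfold_locales (use inj in auto)
  show "lists_rings E t X l"
    using K.sorted_key_list_of_set_unique[OF subset_refl fin, of l] eq
    unfolding linorder_sorted_key_list_of_set by (simp add: lists_rings_def)
qed (rule lists_rings_imp_rings)

lemma lists_rings_length_unique:
  "lists_rings E t X l \<Longrightarrow> lists_rings E t X l' \<Longrightarrow> length l = length l'"
  using lists_rings_imp_rings by metis

lemma measurable_ring_time:
  assumes "i \<in> E \<times> UNIV" shows "(\<lambda>X. ring_time X i) \<in> borel_measurable (noise E)"
proof -
  obtain e k where i: "i = (e, k)" "e \<in> E" using assms by auto
  have "(\<lambda>X. fst (X (e, j))) \<in> borel_measurable (noise E)" for j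
    using i by (intro measurable_wait) auto
  then show ?thesis by (simp add: ring_time_def i)
qed

lemma measurable_lists_rings: "Measurable.pred (noise E) (\<lambda>X. lists_rings E t X l)"
proof (cases "set l \<subseteq> E \<times> UNIV")
  case True
  have m1: "Measurable.pred (noise E) (\<lambda>X. \<forall>i. i \<in> E \<times> UNIV \<longrightarrow> (ring_time X i \<le> t \<longleftrightarrow> i \<in> set l))"
  proof (rule pred_intros_countable(1))
    fix i :: "'a set \<times> nat"
    show "Measurable.pred (noise E) (\<lambda>X. i \<in> E \<times> UNIV \<longrightarrow> (ring_time X i \<le> t \<longleftrightarrow> i \<in> set l))"
    proof (cases "i \<in> E \<times> UNIV")
      case True
      note [measurable] = measurable_ring_time[OF True]
      have "Measurable.pred (noise E) (\<lambda>X. ring_time X i \<le> t)"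
        "Measurable.pred (noise E) (\<lambda>X. \<not> ring_time X i \<le> t)" by measurable
      then show ?thesis using True by (cases "i \<in> set l") simp_all
    next
      case False
      then show ?thesis by simp
    qed
  qed
  have m2: "Measurable.pred (noise E) (\<lambda>X. \<forall>j. \<forall>i. i < j \<and> j < length l \<longrightarrow>
      ring_time X (l ! i) < ring_time X (l ! j))"
  proof (rule pred_intros_countable(1), rule pred_intros_countable(1))
    fix j i :: nat
    show "Measurable.pred (noise E) (\<lambda>X. i < j \<and> j < length l \<longrightarrow>
        ring_time X (l ! i) < ring_time X (l ! j))"
    proof (cases "i < j \<and> j < length l")
      case t: True
      then have "l ! i \<in> set l" "l ! j \<in> set l" by simp_all
      then have i: "l ! i \<in> E \<times> UNIV" and j: "l ! j \<in> E \<times> UNIV" using True by auto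
      note [measurable] = measurable_ring_time[OF i] measurable_ring_time[OF j]
      have "Measurable.pred (noise E) (\<lambda>X. ring_time X (l ! i) < ring_time X (l ! j))"
        by measurable
      then show ?thesis using t by simp
    next
      case False
      then show ?thesis by (simp only: simp_thms) simp
    qed
  qed
  have eq: "lists_rings E t X l = (
      (\<forall>i. i \<in> E \<times> UNIV \<longrightarrow> (ring_time X i \<le> t \<longleftrightarrow> i \<in> set l)) \<and>
      (\<forall>j. \<forall>i. i < j \<and> j < length l \<longrightarrow> ring_time X (l ! i) < ring_time X (l ! j)))" for X
  proof -
    have "set l = {i \<in> E \<times> UNIV. ring_time X i \<le> t} \<longleftrightarrow>
        (\<forall>i. i \<in> E \<times> UNIV \<longrightarrow> (ring_time X i \<le> t \<longleftrightarrow> i \<in> set l))"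
      using True by auto
    moreover have "sorted_wrt (<) (map (ring_time X) l) \<longleftrightarrow>
        (\<forall>j. \<forall>i. i < j \<and> j < length l \<longrightarrow> ring_time X (l ! i) < ring_time X (l ! j))"
      by (auto simp: sorted_wrt_iff_nth_less)
    ultimately show ?thesis by (simp only: lists_rings_def)
  qed
  show ?thesis unfolding eq by (rule pred_intros_logic(3)[OF m1 m2])
next
  case False
  then have eq: "lists_rings E t X l = False" for X by (auto simp: lists_rings_def)
  show ?thesis unfolding eq by simp
qed

lemma measurable_rings: "rings E t \<in> noise E \<rightarrow>\<^sub>M count_space UNIV"
proof (subst measurable_count_space_eq2_countable, intro conjI ballI)
  have nonempty: "rings E t -` {l} \<inter> space (noise E) \<in> sets (noise E)" if "l \<noteq> []" for l
  proof -
    have "rings E t -` {l} \<inter> space (noise E) = {X \<in> space (noise E). lists_rings E t X l}"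
      using rings_eq_iff[OF that] by auto
    then show ?thesis using measurable_lists_rings[of E t l] by (simp add: pred_def)
  qed
  fix l :: "('a set \<times> nat) list"
  show "rings E t -` {l} \<inter> space (noise E) \<in> sets (noise E)"
  proof (cases "l = []")
    case True
    \<comment> \<open>The exceptional set is sent to \<open>[]\<close> as well, so this preimage is
      taken as the complement of the countably many others.\<close>
    have "rings E t -` {l} \<inter> space (noise E) =
        space (noise E) - (\<Union>l'\<in>-{[]}. rings E t -` {l'} \<inter> space (noise E))"
      using True by auto
    also have "\<dots> \<in> sets (noise E)"
      using nonempty by (intro sets.Diff sets.top sets.countable_UN') (auto intro: countableI_type)
    finally show ?thesis .
  qed (rule nonempty)
qed (auto intro: countableI_type)

lemma measurable_receiver[measurable]: "receiver ori thr x e \<in> borel \<rightarrow>\<^sub>M count_space UNIV"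
proof -
  obtain u v where uv: "ori e = (u, v)" by fastforce
  show ?thesis by (simp add: receiver_def[abs_def] uv)
qed

text \<open>Only countably many lists and profiles occur, so it is enough to fold along a fixed
  list. Induction from the right lets the last step act on a profile already known to be
  measurable.\<close>

lemma measurable_load: "load E ori thr t x \<in> noise E \<rightarrow>\<^sub>M count_space UNIV"
proof -
  define step :: "('a set \<times> nat \<Rightarrow> real \<times> real) \<Rightarrow> ('a \<Rightarrow> int) \<Rightarrow> 'a set \<times> nat \<Rightarrow> 'a \<Rightarrow> int"
    where "step = (\<lambda>X y i. add_ball y (receiver ori thr y (fst i) (snd (X i))))"
  have "(\<lambda>X. foldl (step X) x l) \<in> noise E \<rightarrow>\<^sub>M count_space UNIV"
    if "set l \<subseteq> E \<times> UNIV" for l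
    using that
  proof (induction l rule: rev_induct)
    case (snoc i l)
    then have foldl: "(\<lambda>X. foldl (step X) x l) \<in> noise E \<rightarrow>\<^sub>M count_space UNIV"
      and i: "i \<in> E \<times> UNIV" by auto
    note [measurable] = measurable_mark[OF i]
    have "(\<lambda>X. step X y i) \<in> noise E \<rightarrow>\<^sub>M count_space UNIV" for y
    proof -
      have [measurable]: "add_ball y \<in> count_space UNIV \<rightarrow>\<^sub>M count_space UNIV" by simp
      show ?thesis unfolding step_def by measurable
    qed
    then have "(\<lambda>X. step X (foldl (step X) x l) i) \<in> noise E \<rightarrow>\<^sub>M count_space UNIV"
      by (intro measurable_compose_countable[where f="\<lambda>y X. step X y i" and g="\<lambda>X. foldl (step X) x l"] foldl)
    then show ?case by simp
  qed simp
  note fold = this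
  have "(\<lambda>X. foldl (step X) x (rings E t X)) \<in> noise E \<rightarrow>\<^sub>M count_space UNIV"
  proof (rule measurable_compose_countable'[where I="{l. set l \<subseteq> E \<times> UNIV}"])
    show "rings E t \<in> noise E \<rightarrow>\<^sub>M count_space {l. set l \<subseteq> E \<times> UNIV}"
      using measurable_rings[of E t] set_rings[of E t]
      by (auto simp: measurable_count_space_eq2_countable countableI_type)
  qed (use fold in \<open>auto intro: countableI_type\<close>)
  then show ?thesis by (simp add: load_def[abs_def] step_def)
qed

section \<open>Pathwise regeneration at the first ring\<close>

lemma ring_time_next_ring:
  assumes "e \<in> E" "i \<in> E \<times> UNIV"
  shows "ring_time X (next_ring e i) = fst (X (e, 0)) + ring_time (after_ring E e X) i"
proof -
  obtain e' k where i: "i = (e', k)" "e' \<in> E" using assms by auto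
  show ?thesis
  proof (cases "e' = e")
    case True
    then show ?thesis using i
      by (simp add: ring_time_def next_ring_def after_ring_def sum.atMost_Suc_shift del: sum.atMost_Suc)
  next
    \<comment> \<open>The time that \<open>time_shift\<close> takes from waiting time
      \<open>0\<close> is given back by the summand \<open>fst (X (e, 0))\<close>.\<close>
    case False
    then show ?thesis using i
      by (simp add: ring_time_def next_ring_def after_ring_def time_shift_def sum.atMost_shift)
  qed
qed

lemma insert_next_ring_image:
  "e \<in> E \<Longrightarrow> E \<times> UNIV = insert (e, 0) (next_ring e ` (E \<times> UNIV))"
proof (intro set_eqI iffI)
  fix i :: "'a set \<times> nat" assume e: "e \<in> E" and i: "i \<in> E \<times> UNIV"
  obtain e' k where ek: "i = (e', k)" by fastforce
  show "i \<in> insert (e, 0) (next_ring e ` (E \<times> UNIV))"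
  proof (cases "e' = e \<and> k > 0")
    case True
    then have "i = next_ring e (e, k - 1)" by (simp add: next_ring_def ek)
    then show ?thesis using e by auto
  next
    case False
    then show ?thesis using i by (cases "e' = e") (auto simp: next_ring_def ek image_iff)
  qed
qed (auto simp: next_ring_def split: if_splits)

lemma after_ring_pos:
  assumes "e \<in> E" "first_ring E e X" "\<forall>i\<in>E \<times> UNIV. 0 < fst (X i)"
  shows "\<forall>i\<in>E \<times> UNIV. 0 < fst (after_ring E e X i)"
  using assms by (auto simp: after_ring_def first_ring_def time_shift_def next_ring_def)

lemma ring_time_pos:
  assumes "\<forall>i\<in>E \<times> UNIV. 0 < fst (X i)" "i \<in> E \<times> UNIV"
  shows "0 < ring_time X i"
  using assms by (auto simp: ring_time_def intro!: sum_pos)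

text \<open>All later rings are delayed by the same amount, so their order is kept, and positive
  waiting times put \<open>(e, 0)\<close> strictly before them.\<close>

lemma lists_rings_Cons:
  assumes e: "e \<in> E" and first: "first_ring E e X" and pos: "\<forall>i\<in>E \<times> UNIV. 0 < fst (X i)"
    and t: "fst (X (e, 0)) \<le> t" and l: "lists_rings E (t - fst (X (e, 0))) (after_ring E e X) l"
  shows "lists_rings E t X ((e, 0) # map (next_ring e) l)"
proof -
  note rt = ring_time_next_ring[OF e, of _ X]
  have rt0: "ring_time X (e, 0) = fst (X (e, 0))" by (simp add: ring_time_def)
  have sl: "set l = {i \<in> E \<times> UNIV. ring_time (after_ring E e X) i \<le> t - fst (X (e, 0))}"
    and so: "sorted_wrt (<) (map (ring_time (after_ring E e X)) l)"
    using l by (auto simp: lists_rings_def)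
  have "{i \<in> E \<times> UNIV. ring_time X i \<le> t} =
      insert (e, 0) (next_ring e ` {i \<in> E \<times> UNIV. ring_time X (next_ring e i) \<le> t})"
    using t rt0 by (subst insert_next_ring_image[OF e]) auto
  also have "\<dots> = insert (e, 0) (next_ring e ` set l)"
    unfolding sl using rt by (intro arg_cong2[where f=insert] image_cong refl) auto
  finally have set: "set ((e, 0) # map (next_ring e) l) = {i \<in> E \<times> UNIV. ring_time X i \<le> t}"
    by simp
  have "sorted_wrt (\<lambda>i j. ring_time X (next_ring e i) < ring_time X (next_ring e j)) l"
    using so unfolding sorted_wrt_map
    by (rule sorted_wrt_mono_rel[rotated]) (use sl rt in auto)
  moreover have "ring_time X (e, 0) < ring_time X (next_ring e i)" if "i \<in> set l" for i
    using that sl rt ring_time_pos[OF after_ring_pos[OF e first pos], of i] by (simp add: rt0)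
  ultimately show ?thesis
    using set by (simp add: lists_rings_def sorted_wrt_map)
qed

text \<open>A pathwise Markov property: \<open>after_ring\<close> leaves the marks alone, so folding
  along the renumbered rings is the same as running the later noise.\<close>

lemma load_first_ring:
  assumes "e \<in> E" "first_ring E e X" "\<forall>i\<in>E \<times> UNIV. 0 < fst (X i)"
    "fst (X (e, 0)) \<le> t" and l: "lists_rings E (t - fst (X (e, 0))) (after_ring E e X) l"
  shows "load E ori thr t x X = load E ori thr (t - fst (X (e, 0)))
    (add_ball x (receiver ori thr x e (snd (X (e, 0))))) (after_ring E e X)"
proof -
  have sl: "set l \<subseteq> E \<times> UNIV" using l by (auto simp: lists_rings_def)
  have *: "foldl (\<lambda>y i. add_ball y (receiver ori thr y (fst i) (snd (X i)))) y (map (next_ring e) l) =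
    foldl (\<lambda>y i. add_ball y (receiver ori thr y (fst i) (snd (after_ring E e X i)))) y l" for y
    using sl by (induction l arbitrary: y)
      (auto simp: after_ring_def next_ring_def time_shift_def split: prod.splits)
  show ?thesis
    unfolding load_def lists_rings_imp_rings[OF lists_rings_Cons[OF assms]] lists_rings_imp_rings[OF l]
    using * by simp
qed

section \<open>The law of the load\<close>

text \<open>The indicator of having exactly \<open>n\<close> rings up to time \<open>t\<close> and load \<open>y\<close> afterwards, written by
  decomposition at the first ring so that regeneration applies.\<close>
primrec arrival ::
  "'v::finite set set \<Rightarrow> ('v set \<Rightarrow> 'v \<times> 'v) \<Rightarrow> ('v set \<Rightarrow> int \<Rightarrow> real) \<Rightarrow> ('v \<Rightarrow> int) \<Rightarrow>
    nat \<Rightarrow> real \<Rightarrow> ('v \<Rightarrow> int) \<Rightarrow> ('v set \<times> nat \<Rightarrow> real \<times> real) \<Rightarrow> ennreal" where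
  "arrival E ori thr y 0 t x X = indicator {y} x * indicator {X. \<forall>e\<in>E. t < fst (X (e, 0))} X"
| "arrival E ori thr y (Suc n) t x X =
    (\<Sum>e\<in>E. indicator {X. first_ring E e X} X * (indicator {..t} (fst (X (e, 0))) *
      arrival E ori thr y n (t - fst (X (e, 0)))
        (add_ball x (receiver ori thr x e (snd (X (e, 0))))) (after_ring E e X)))"

lemma first_ring_unique:
  "e \<in> E \<Longrightarrow> e' \<in> E \<Longrightarrow> first_ring E e X \<Longrightarrow> first_ring E e' X \<Longrightarrow> e = e'"
  unfolding first_ring_def by (metis DiffI less_asym singletonD)

text \<open>At most one summand of the recursion is nonzero, since the first edge is unique. The
  witness \<open>l\<close> is exported because its length determines \<open>n\<close>: this makes
  the events for different \<open>n\<close> disjoint in \<open>suminf_arrival_le\<close>.\<close>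

lemma arrival_le_load:
  assumes "\<forall>i\<in>E \<times> UNIV. 0 < fst (X i)" "arrival E ori thr y n t x X \<noteq> 0"
  shows "\<exists>l. lists_rings E t X l \<and> length l = n \<and>
    arrival E ori thr y n t x X \<le> indicator {y} (load E ori thr t x X)"
  using assms
proof (induction n arbitrary: t x X)
  case 0
  have "t < ring_time X i" if i: "i \<in> E \<times> UNIV" for i
  proof -
    obtain e k where ek: "i = (e, k)" "e \<in> E" using i by auto
    have "t < fst (X (e, 0))" using 0 ek by (auto simp: indicator_def split: if_splits)
    also have "\<dots> \<le> ring_time X i"
    proof -
      have "(\<Sum>j\<in>{0}. fst (X (e, j))) \<le> (\<Sum>j\<le>k. fst (X (e, j)))"
        using 0 ek by (intro sum_mono2) (auto intro: less_imp_le)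
      then show ?thesis by (simp add: ring_time_def ek)
    qed
    finally show ?thesis .
  qed
  then have l: "lists_rings E t X []" by (auto simp: lists_rings_def not_le)
  have "load E ori thr t x X = x" by (simp add: load_def lists_rings_imp_rings[OF l])
  then show ?case using l by (auto simp: indicator_def)
next
  case (Suc n)
  let ?f = "\<lambda>e. indicator {X. first_ring E e X} X * (indicator {..t} (fst (X (e, 0))) *
      arrival E ori thr y n (t - fst (X (e, 0)))
        (add_ball x (receiver ori thr x e (snd (X (e, 0))))) (after_ring E e X))"
  from Suc.prems(2) obtain e where e: "e \<in> E" and ne: "?f e \<noteq> 0"
    by (metis (no_types, lifting) arrival.simps(2) sum.neutral)
  then have first: "first_ring E e X" and t: "fst (X (e, 0)) \<le> t"
    and ne': "arrival E ori thr y n (t - fst (X (e, 0)))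
        (add_ball x (receiver ori thr x e (snd (X (e, 0))))) (after_ring E e X) \<noteq> 0"
    by (auto simp: indicator_def split: if_splits)
  have "?f e' = 0" if "e' \<in> E - {e}" for e'
  proof -
    have "\<not> first_ring E e' X" using that first_ring_unique[OF _ e _ first] by blast
    then show ?thesis by simp
  qed
  then have "arrival E ori thr y (Suc n) t x X = (\<Sum>e'\<in>{e}. ?f e')"
    unfolding arrival.simps using e by (intro sum.mono_neutral_right) auto
  then have eq: "arrival E ori thr y (Suc n) t x X = arrival E ori thr y n (t - fst (X (e, 0)))
        (add_ball x (receiver ori thr x e (snd (X (e, 0))))) (after_ring E e X)"
    using first t by simp
  from Suc.IH[OF after_ring_pos[OF e first Suc.prems(1)] ne'] obtain l
    where l: "lists_rings E (t - fst (X (e, 0))) (after_ring E e X) l" "length l = n"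
      and le: "arrival E ori thr y n (t - fst (X (e, 0)))
        (add_ball x (receiver ori thr x e (snd (X (e, 0))))) (after_ring E e X) \<le>
        indicator {y} (load E ori thr (t - fst (X (e, 0)))
          (add_ball x (receiver ori thr x e (snd (X (e, 0))))) (after_ring E e X))"
    by blast
  show ?case
    using lists_rings_Cons[OF e first Suc.prems(1) t l(1)] l(2) le
    unfolding eq load_first_ring[OF e first Suc.prems(1) t l(1)]
    by (intro exI[of _ "(e, 0) # map (next_ring e) l"]) simp
qed

lemma suminf_arrival_le:
  assumes "\<forall>i\<in>E \<times> UNIV. 0 < fst (X i)"
  shows "(\<Sum>n. arrival E ori thr y n t x X) \<le> indicator {y} (load E ori thr t x X)"
proof (cases "\<exists>n. arrival E ori thr y n t x X \<noteq> 0")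
  case True
  then obtain n where n: "arrival E ori thr y n t x X \<noteq> 0" by blast
  have "arrival E ori thr y k t x X = 0" if "k \<notin> {n}" for k
    using that arrival_le_load[OF assms, of ori thr y k] arrival_le_load[OF assms n]
      lists_rings_length_unique by (metis singletonI)
  then have "(\<Sum>k. arrival E ori thr y k t x X) = (\<Sum>k\<in>{n}. arrival E ori thr y k t x X)"
    by (intro suminf_finite) auto
  then show ?thesis using arrival_le_load[OF assms n] by auto
qed simp

text \<open>The recursion evaluates \<open>arrival\<close> at a random remaining time, hence the
  joint measurability in time and noise.\<close>

lemma measurable_arrival:
  "(\<lambda>(t, X). arrival E ori thr y n t x X) \<in> borel_measurable (borel \<Otimes>\<^sub>M noise E)"
proof (induction n arbitrary: x)
  case 0
  have [measurable]: "(\<lambda>X. fst (X (e, 0))) \<in> borel_measurable (noise E)" if "e \<in> E" for e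
    using that by (intro measurable_wait) auto
  have "(\<lambda>z. indicator {y} x * indicator {z. \<forall>e\<in>E. fst z < fst (snd z (e, 0))} z :: ennreal)
      \<in> borel_measurable (borel \<Otimes>\<^sub>M noise E)"
    by measurable
  then show ?case by (simp add: case_prod_beta indicator_def cong: if_cong)
next
  case (Suc n)
  have "(\<lambda>z. indicator {X. first_ring E e X} (snd z) * (indicator {..fst z} (fst (snd z (e, 0))) *
      arrival E ori thr y n (fst z - fst (snd z (e, 0)))
        (add_ball x (receiver ori thr x e (snd (snd z (e, 0))))) (after_ring E e (snd z)))) \<in>
      borel_measurable (borel \<Otimes>\<^sub>M noise E)" if e: "e \<in> E" for e
  proof -
    note [measurable] = measurable_first_ring[OF e] measurable_after_ring[OF e]
    have [measurable]: "(\<lambda>X. fst (X (e, 0))) \<in> borel_measurable (noise E)"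
      "(\<lambda>X. snd (X (e, 0))) \<in> borel_measurable (noise E)"
      using e by (auto intro: measurable_wait measurable_mark)
    have arr: "(\<lambda>z. arrival E ori thr y n (fst z - fst (snd z (e, 0)))
        (add_ball x (receiver ori thr x e (snd (snd z (e, 0))))) (after_ring E e (snd z))) \<in>
      borel_measurable (borel \<Otimes>\<^sub>M noise E)"
    proof (rule measurable_compose_countable[where g="\<lambda>z. add_ball x (receiver ori thr x e (snd (snd z (e, 0))))"
          and f="\<lambda>x z. arrival E ori thr y n (fst z - fst (snd z (e, 0))) x (after_ring E e (snd z))"])
      have [measurable]: "add_ball x \<in> count_space UNIV \<rightarrow>\<^sub>M count_space UNIV" by simp
      show "(\<lambda>z. add_ball x (receiver ori thr x e (snd (snd z (e, 0))))) \<in>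
          borel \<Otimes>\<^sub>M noise E \<rightarrow>\<^sub>M count_space UNIV" by measurable
      fix x
      have "(\<lambda>z. (fst z - fst (snd z (e, 0)), after_ring E e (snd z))) \<in>
          borel \<Otimes>\<^sub>M noise E \<rightarrow>\<^sub>M borel \<Otimes>\<^sub>M noise E" by measurable
      from measurable_compose[OF this Suc.IH]
      show "(\<lambda>z. arrival E ori thr y n (fst z - fst (snd z (e, 0))) x (after_ring E e (snd z)))
          \<in> borel_measurable (borel \<Otimes>\<^sub>M noise E)" by simp
    qed
    have "Measurable.pred (borel \<Otimes>\<^sub>M noise E) (\<lambda>z. first_ring E e (snd z))"
      by (rule measurable_compose[OF measurable_snd measurable_first_ring[OF e]])
    moreover have "Measurable.pred (borel \<Otimes>\<^sub>M noise E) (\<lambda>z. fst (snd z (e, 0)) \<le> fst z)"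
      by measurable
    ultimately show ?thesis
      using arr by (intro borel_measurable_times_ennreal) (simp_all add: indicator_def)
  qed
  then show ?case unfolding arrival.simps case_prod_beta by (rule borel_measurable_sum)
qed

text \<open>\<^const>\<open>poisson_pmf\<close> is meaningful only for positive rates.\<close>
definition poisson_law :: "real \<Rightarrow> nat pmf" where
  "poisson_law r = (if r = 0 then return_pmf 0 else poisson_pmf r)"

lemma pmf_poisson_law: "0 \<le> r \<Longrightarrow> pmf (poisson_law r) k = r ^ k / fact k * exp (- r)"
  by (auto simp: poisson_law_def indicator_def power_0_left)

text \<open>A discrete convolution evaluated by the binomial theorem; the semigroup property of
  \<open>trans\<close> rests on it.\<close>

lemma poisson_law_add:
  assumes "0 \<le> a" "0 \<le> b"
  shows "bind_pmf (poisson_law a) (\<lambda>n. map_pmf ((+) n) (poisson_law b)) = poisson_law (a + b)"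
proof (rule pmf_eqI)
  fix N
  have shift: "pmf (map_pmf ((+) n) (poisson_law b)) N = (if n \<le> N then pmf (poisson_law b) (N - n) else 0)" for n
  proof (cases "n \<le> N")
    case True
    then have "((+) n) -` {N} = {N - n}" by auto
    then show ?thesis using True by (simp add: pmf_map measure_pmf_single)
  next
    case False
    then have "((+) n) -` {N} = {}" by auto
    then show ?thesis using False by (simp add: pmf_map)
  qed
  have "pmf (bind_pmf (poisson_law a) (\<lambda>n. map_pmf ((+) n) (poisson_law b))) N =
      (\<Sum>n\<le>N. pmf (poisson_law a) n * pmf (poisson_law b) (N - n))"
    unfolding pmf_bind shift
    by (subst integral_measure_pmf[where A="{..N}"]) (auto split: if_splits)
  also have "\<dots> = (\<Sum>n\<le>N. real (N choose n) * a ^ n * b ^ (N - n)) / fact N * exp (- (a + b))"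
    unfolding sum_divide_distrib sum_distrib_right
    by (intro sum.cong refl)
      (simp add: pmf_poisson_law assms binomial_fact exp_diff exp_minus field_simps exp_add)
  also have "\<dots> = pmf (poisson_law (a + b)) N"
    by (simp add: pmf_poisson_law assms binomial_ring)
  finally show "pmf (bind_pmf (poisson_law a) (\<lambda>n. map_pmf ((+) n) (poisson_law b))) N =
    pmf (poisson_law (a + b)) N" .
qed

section \<open>Embedded chain, Poisson clock and semigroup\<close>

locale local_rule =
  fixes E :: "'v::finite set set" and ori :: "'v set \<Rightarrow> 'v \<times> 'v" and thr :: "'v set \<Rightarrow> int \<Rightarrow> real"
  assumes graph: "simple_graph E" and rule: "endpoint_local_monotone_rule E ori thr"
    and edges: "card E \<ge> 1"
begin

lemma card_neq_0: "real (card E) \<noteq> 0"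
  using edges by linarith

text \<open>The law of the vertex that receives the next ball. It coincides with the Palm law
  (\<open>palm_law_eq\<close>), so the one-ring term of a variance becomes a statement about the
  Palm-initialized tag.\<close>

definition recv :: "('v \<Rightarrow> int) \<Rightarrow> 'v pmf" where
  "recv x = embed_pmf (\<lambda>w. rate E ori thr x w / real (card E))"

lemma rate_nonneg: "0 \<le> rate E ori thr x w"
  unfolding rate_def by (intro sum_nonneg) auto

lemma pmf_recv: "pmf (recv x) w = rate E ori thr x w / real (card E)"
  unfolding recv_def
proof (rule pmf_embed_pmf)
  have "(\<Sum>w\<in>UNIV. rate E ori thr x w / real (card E)) = 1"
    unfolding sum_divide_distrib[symmetric] sum_rate[OF rule graph]
    by (rule divide_self) (rule card_neq_0)
  then show "(\<integral>\<^sup>+w. ennreal (rate E ori thr x w / real (card E)) \<partial>count_space UNIV) = 1"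
    by (simp add: nn_integral_count_space_finite rate_nonneg)
qed (simp add: rate_nonneg)

lemma palm_law_eq: "palm_law E ori thr x = measure_pmf (recv x)"
  by (simp add: measure_pmf_eq_density palm_law_def pmf_recv)

text \<open>Every edge rings at rate one, so summing over the edges weights each vertex by its
  \<open>rate\<close>, which is \<open>card E\<close> times its mass under
  \<open>recv\<close>.\<close>

lemma nn_integral_recv:
  "(\<Sum>e\<in>E. \<integral>\<^sup>+U. g (receiver ori thr x e U) \<partial>mark_law) = of_nat (card E) * (\<integral>\<^sup>+w. g w \<partial>recv x)"
proof -
  have "(\<integral>\<^sup>+U. g (receiver ori thr x e U) \<partial>mark_law) =
      (\<Sum>w\<in>UNIV. g w * ennreal (\<P>(U in mark_law. receiver ori thr x e U = w)))" for e
  proof -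
    interpret U: prob_space mark_law by (rule prob_space_mark_law)
    have [measurable]: "receiver ori thr x e \<in> mark_law \<rightarrow>\<^sub>M count_space UNIV"
      using measurable_receiver[of ori thr x e] by (simp cong: measurable_cong_sets)
    have "(\<integral>\<^sup>+U. g (receiver ori thr x e U) \<partial>mark_law) =
        (\<integral>\<^sup>+U. (\<Sum>w\<in>UNIV. g w * indicator {U. receiver ori thr x e U = w} U) \<partial>mark_law)"
      by (intro nn_integral_cong) (simp add: indicator_def sum.delta if_distrib cong: if_cong)
    also have "\<dots> = (\<Sum>w\<in>UNIV. g w * emeasure mark_law {U. receiver ori thr x e U = w})"
    proof (subst nn_integral_sum)
      have [measurable]: "{U. receiver ori thr x e U = w} \<in> sets mark_law" for w
        using measurable_sets[OF \<open>receiver ori thr x e \<in> mark_law \<rightarrow>\<^sub>M count_space UNIV\<close>, of "{w}"]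
        by (simp add: vimage_def)
      show "(\<lambda>U. g w * indicator {U. receiver ori thr x e U = w} U) \<in> borel_measurable mark_law" for w
        by measurable
      show "(\<Sum>w\<in>UNIV. \<integral>\<^sup>+U. g w * indicator {U. receiver ori thr x e U = w} U \<partial>mark_law) =
          (\<Sum>w\<in>UNIV. g w * emeasure mark_law {U. receiver ori thr x e U = w})"
        by (intro sum.cong refl nn_integral_cmult_indicator) measurable
    qed
    finally show ?thesis by (simp add: U.emeasure_eq_measure)
  qed
  then have "(\<Sum>e\<in>E. \<integral>\<^sup>+U. g (receiver ori thr x e U) \<partial>mark_law) =
      (\<Sum>w\<in>UNIV. g w * ennreal (rate E ori thr x w))"
    by (simp add: rate_def sum.swap[of _ _ E] sum_ennreal flip: sum_distrib_left)
  also have "\<dots> = (\<Sum>w\<in>UNIV. of_nat (card E) * (g w * ennreal (pmf (recv x) w)))"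
  proof (rule sum.cong[OF refl])
    fix w
    have "ennreal (rate E ori thr x w) = of_nat (card E) * ennreal (pmf (recv x) w)"
      using card_neq_0 by (simp add: pmf_recv ennreal_of_nat_eq_real_of_nat rate_nonneg flip: ennreal_mult)
    then show "g w * ennreal (rate E ori thr x w) = of_nat (card E) * (g w * ennreal (pmf (recv x) w))"
      by (simp add: ac_simps)
  qed
  also have "\<dots> = of_nat (card E) * (\<integral>\<^sup>+w. g w \<partial>recv x)"
    by (subst nn_integral_measure_pmf)
      (simp add: nn_integral_count_space_finite sum_distrib_left mult.commute)
  finally show ?thesis .
qed

primrec jumps :: "nat \<Rightarrow> ('v \<Rightarrow> int) \<Rightarrow> ('v \<Rightarrow> int) pmf" where
  "jumps 0 x = return_pmf x"
| "jumps (Suc n) x = bind_pmf (recv x) (\<lambda>w. jumps n (add_ball x w))"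

lemma jumps_add: "bind_pmf (jumps n x) (jumps k) = jumps (n + k) x"
  by (induction n arbitrary: x) (simp_all add: bind_return_pmf bind_assoc_pmf)

text \<open>Uniformization: the total rate \<open>card E\<close> is the same in every profile, so
  the number of rings is Poisson and independent of the embedded chain \<open>jumps\<close>.\<close>

definition trans :: "real \<Rightarrow> ('v \<Rightarrow> int) \<Rightarrow> ('v \<Rightarrow> int) pmf" where
  "trans t x = bind_pmf (poisson_law (real (card E) * t)) (\<lambda>n. jumps n x)"

text \<open>Chapman-Kolmogorov. The number of steps in the second period does not depend on the
  profile, so it can be drawn in advance; the two numbers then add up to a Poisson number
  again.\<close>

lemma trans_add:
  assumes "0 \<le> s" "0 \<le> h" shows "bind_pmf (trans s x) (trans h) = trans (s + h) x"
proof -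
  let ?m = "real (card E)"
  have "bind_pmf (trans s x) (trans h) = bind_pmf (poisson_law (?m * s)) (\<lambda>n.
      bind_pmf (poisson_law (?m * h)) (\<lambda>k. bind_pmf (jumps n x) (jumps k)))"
    unfolding trans_def bind_assoc_pmf by (subst bind_commute_pmf) simp
  also have "\<dots> = bind_pmf (bind_pmf (poisson_law (?m * s)) (\<lambda>n. map_pmf ((+) n) (poisson_law (?m * h))))
      (\<lambda>n. jumps n x)"
    unfolding jumps_add bind_assoc_pmf bind_map_pmf ..
  also have "\<dots> = trans (s + h) x"
    using assms by (simp add: poisson_law_add trans_def distrib_left)
  finally show ?thesis .
qed

lemma nn_integral_no_ring:
  assumes t: "0 \<le> t"
  shows "(\<integral>\<^sup>+X. indicator {X. \<forall>e\<in>E. t < fst (X (e, 0))} X \<partial>noise E) = ennreal (exp (- (real (card E) * t)))"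
proof -
  interpret noise: prob_space "noise E" by (rule prob_space_noise)
  have "(\<integral>\<^sup>+X. indicator {X. \<forall>e\<in>E. t < fst (X (e, 0))} X \<partial>noise E) =
      (\<integral>\<^sup>+X. (\<Prod>i\<in>E \<times> {0}. indicator {z. t < fst z} (X i)) *
         (\<lambda>_. 1) (\<lambda>i\<in>E \<times> UNIV. if i \<in> E \<times> {0} then time_shift t (X i) else X i) \<partial>noise E)"
    by (intro nn_integral_cong, subst prod_indicator_ennreal) (auto simp: indicator_def)
  also have "\<dots> = ennreal (exp (- t)) ^ card (E \<times> {0::nat}) * (\<integral>\<^sup>+X. 1 \<partial>noise E)"
    unfolding noise_def
  proof (rule nn_integral_PiM_transform_coords[OF prob_space_ring_law])
    show "(\<integral>\<^sup>+y. indicator {z. t < fst z} y * \<phi> (time_shift t y) \<partial>ring_law) =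
        ennreal (exp (- t)) * integral\<^sup>N ring_law \<phi>" if "\<phi> \<in> borel_measurable ring_law" for \<phi>
      unfolding time_shift_def using prob_space_mark_law that t
      by (intro nn_integral_exp_pair_shift) auto
  qed auto
  also have "\<dots> = ennreal (exp (- (real (card E) * t)))"
    by (simp add: noise.emeasure_space_1 card_cartesian_product ennreal_power exp_of_nat_mult[symmetric])
  finally show ?thesis .
qed

text \<open>Conditioning on the time \<open>s\<close> of the first ring: its density, the survival
  of the other clocks and the \<open>n\<close> rings in the remaining time have exponentials whose
  product \<open>exp (- m t)\<close>, with \<open>m = card E\<close>, is free of \<open>s\<close>.
  Only a power of \<open>t - s\<close> is left to integrate, and the factor \<open>m\<close> counts
  the edges that may ring first.\<close>

lemma nn_integral_first_ring_time:
  assumes t: "0 \<le> t"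
  shows "(\<integral>\<^sup>+s. ennreal (exp (- s)) ^ (card E - 1) * (indicator {..t} s *
      ennreal ((real (card E) * (t - s)) ^ n / fact n * exp (- (real (card E) * (t - s))))) \<partial>exp_law) *
      of_nat (card E) =
    ennreal (pmf (poisson_law (real (card E) * t)) (Suc n))"
proof -
  let ?m = "real (card E)"
  let ?f = "\<lambda>s. exp (- (?m * t)) * (?m ^ Suc n * (t - s) ^ n / fact n)"
  let ?F = "\<lambda>s. - (exp (- (?m * t)) * (?m ^ Suc n * (t - s) ^ Suc n / fact (Suc n)))"
  let ?h = "\<lambda>s. ennreal (exp (- s)) ^ (card E - 1) * (indicator {..t} s *
      ennreal ((?m * (t - s)) ^ n / fact n * exp (- (?m * (t - s)))))"
  have "(\<integral>\<^sup>+s. ?h s \<partial>exp_law) * of_nat (card E) = (\<integral>\<^sup>+s. ?h s * ennreal ?m \<partial>exp_law)"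
    by (subst nn_integral_multc) (auto simp: ennreal_of_nat_eq_real_of_nat)
  also have "\<dots> = (\<integral>\<^sup>+s. ennreal (exponential_density 1 s) * ?h s * ennreal ?m \<partial>lborel)"
    by (subst nn_integral_density) (auto simp: mult.assoc)
  also have "\<dots> = (\<integral>\<^sup>+s. ennreal (?f s) * indicator {0..t} s \<partial>lborel)"
  proof (intro nn_integral_cong)
    fix s
    show "ennreal (exponential_density 1 s) * (ennreal (exp (- s)) ^ (card E - 1) * (indicator {..t} s *
      ennreal ((?m * (t - s)) ^ n / fact n * exp (- (?m * (t - s)))))) * ennreal ?m =
      ennreal (?f s) * indicator {0..t} s"
    proof (cases "0 \<le> s \<and> s \<le> t")
      case True
      have "exp (- s) * exp (- s) ^ (card E - 1) = exp (- (?m * s))"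
        using edges power_Suc[of "exp (- s)" "card E - 1"] by (simp add: exp_of_nat_mult[symmetric])
      then have "exp (- s) * exp (- s) ^ (card E - 1) * exp (- (?m * (t - s))) = exp (- (?m * t))"
        by (simp add: exp_add[symmetric] algebra_simps)
      then show ?thesis using True
        by (simp add: exponential_density_def ennreal_power power_mult_distrib mult_ac flip: ennreal_mult)
    qed (auto simp: exponential_density_def indicator_def)
  qed
  also have "\<dots> = ennreal (?F t - ?F 0)"
  proof (rule nn_integral_FTC_Icc)
    show "?f \<in> borel_measurable borel" by measurable
    show "0 \<le> ?f s" if "s \<in> {0..t}" for s using that by simp
    show "(?F has_real_derivative ?f s) (at s)" if "s \<in> {0..t}" for s
      by (auto intro!: derivative_eq_intros simp: field_simps simp del: power_Suc of_nat_Suc) 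
  qed (use t in auto)
  also have "?F t - ?F 0 = pmf (poisson_law (?m * t)) (Suc n)"
    using t by (simp add: pmf_poisson_law power_mult_distrib)
  finally show ?thesis .
qed

text \<open>The number of rings is independent of the embedded chain. By regeneration the time of
  the first ring and its mark enter as separate factors, so the product form survives the
  induction.\<close>

lemma nn_integral_arrival:
  assumes "0 \<le> t"
  shows "(\<integral>\<^sup>+X. arrival E ori thr y n t x X \<partial>noise E) =
    ennreal (pmf (poisson_law (real (card E) * t)) n) * ennreal (pmf (jumps n x) y)"
  using assms
proof (induction n arbitrary: t x)
  case 0
  have [measurable]: "(\<lambda>X. fst (X (e, 0))) \<in> borel_measurable (noise E)" if "e \<in> E" for e
    using that by (intro measurable_wait) auto
  have "(\<integral>\<^sup>+X. arrival E ori thr y 0 t x X \<partial>noise E) =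
      indicator {y} x * (\<integral>\<^sup>+X. indicator {X. \<forall>e\<in>E. t < fst (X (e, 0))} X \<partial>noise E)"
    by (simp, subst nn_integral_cmult) (auto simp: indicator_def)
  then show ?case using 0 nn_integral_no_ring[of t]
    by (simp add: pmf_poisson_law indicator_def mult.commute)
next
  case (Suc n)
  let ?m = "real (card E)"
  define \<Psi> where "\<Psi> = (\<lambda>e z. indicator {..t} (fst (fst z)) *
      arrival E ori thr y n (t - fst (fst z)) (add_ball x (receiver ori thr x e (snd (fst z)))) (snd z))"
  let ?g = "\<lambda>w. ennreal (pmf (jumps n (add_ball x w)) y)"
  let ?f = "\<lambda>s. ennreal (exp (- s)) ^ (card E - 1) * (indicator {..t} s *
      ennreal ((?m * (t - s)) ^ n / fact n * exp (- (?m * (t - s)))))"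
  let ?A = "\<integral>\<^sup>+s. ?f s \<partial>exp_law"
  interpret U: prob_space mark_law by (rule prob_space_mark_law)
  have \<Psi>: "\<Psi> e \<in> borel_measurable (ring_law \<Otimes>\<^sub>M noise E)" for e
  proof -
    have "(\<lambda>z. arrival E ori thr y n (t - fst (fst z)) (add_ball x (receiver ori thr x e (snd (fst z)))) (snd z))
        \<in> borel_measurable (ring_law \<Otimes>\<^sub>M noise E)"
    proof (rule measurable_compose_countable[where g="\<lambda>z. add_ball x (receiver ori thr x e (snd (fst z)))"
          and f="\<lambda>x z. arrival E ori thr y n (t - fst (fst z)) x (snd z)"])
      have [measurable]: "add_ball x \<in> count_space UNIV \<rightarrow>\<^sub>M count_space UNIV" by simp
      show "(\<lambda>z. add_ball x (receiver ori thr x e (snd (fst z)))) \<in>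
          ring_law \<Otimes>\<^sub>M noise E \<rightarrow>\<^sub>M count_space UNIV" by measurable
      fix x
      have "(\<lambda>z. (t - fst (fst z), snd z)) \<in> ring_law \<Otimes>\<^sub>M noise E \<rightarrow>\<^sub>M borel \<Otimes>\<^sub>M noise E"
        by measurable
      from measurable_compose[OF this measurable_arrival]
      show "(\<lambda>z. arrival E ori thr y n (t - fst (fst z)) x (snd z))
          \<in> borel_measurable (ring_law \<Otimes>\<^sub>M noise E)" by simp
    qed
    then show ?thesis unfolding \<Psi>_def by measurable
  qed
  have meas: "(\<lambda>X. indicator {X. first_ring E e X} X * \<Psi> e (X (e, 0), after_ring E e X))
      \<in> borel_measurable (noise E)" if e: "e \<in> E" for e
  proof -
    have "(\<lambda>X. (X (e, 0), after_ring E e X)) \<in> noise E \<rightarrow>\<^sub>M ring_law \<Otimes>\<^sub>M noise E"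
      using e by (intro measurable_Pair measurable_after_ring measurable_noise_component) auto
    from measurable_compose[OF this \<Psi>]
    have [measurable]: "(\<lambda>X. \<Psi> e (X (e, 0), after_ring E e X)) \<in> borel_measurable (noise E)" .
    note [measurable] = measurable_first_ring[OF e]
    have "(\<lambda>X. if first_ring E e X then \<Psi> e (X (e, 0), after_ring E e X) else 0) \<in> borel_measurable (noise E)"
      by measurable
    moreover have "indicator {X. first_ring E e X} X * \<Psi> e (X (e, 0), after_ring E e X) =
        (if first_ring E e X then \<Psi> e (X (e, 0), after_ring E e X) else 0)" for X
      by simp
    ultimately show ?thesis by (simp only:)
  qed
  have "(\<integral>\<^sup>+X. arrival E ori thr y (Suc n) t x X \<partial>noise E) =
      (\<Sum>e\<in>E. \<integral>\<^sup>+X. indicator {X. first_ring E e X} X * \<Psi> e (X (e, 0), after_ring E e X) \<partial>noise E)"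
    by (subst nn_integral_sum[OF meas, symmetric], assumption, intro nn_integral_cong)
      (simp only: arrival.simps \<Psi>_def fst_conv snd_conv)
  also have "\<dots> = (\<Sum>e\<in>E. ?A * (\<integral>\<^sup>+U. ?g (receiver ori thr x e U) \<partial>mark_law))"
  proof (rule sum.cong[OF refl])
    fix e assume e: "e \<in> E"
    have [measurable]: "receiver ori thr x e \<in> mark_law \<rightarrow>\<^sub>M count_space UNIV"
      using measurable_receiver[of ori thr x e] by (simp cong: measurable_cong_sets)
    have "(\<integral>\<^sup>+X. indicator {X. first_ring E e X} X * \<Psi> e (X (e, 0), after_ring E e X) \<partial>noise E) =
      (\<integral>\<^sup>+z. ennreal (exp (- (fst z))) ^ (card E - 1) * (\<integral>\<^sup>+X. \<Psi> e (z, X) \<partial>noise E) \<partial>ring_law)"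
      using e \<Psi> by (rule nn_integral_noise_first_ring)
    also have "\<dots> = (\<integral>\<^sup>+z. ?f (fst z) * ?g (receiver ori thr x e (snd z)) \<partial>ring_law)"
    proof (rule nn_integral_cong)
      fix z
      show "ennreal (exp (- (fst z))) ^ (card E - 1) * (\<integral>\<^sup>+X. \<Psi> e (z, X) \<partial>noise E) =
          ?f (fst z) * ?g (receiver ori thr x e (snd z))"
        \<comment> \<open>The induction hypothesis asks for \<open>fst z <= t\<close>; beyond
          \<open>t\<close> the indicator makes both sides vanish.\<close>
        using Suc.IH[of "t - fst z" "add_ball x (receiver ori thr x e (snd z))"]
        by (cases "fst z \<le> t") (simp_all add: \<Psi>_def mult.assoc pmf_poisson_law)
    qed
    also have "\<dots> = (\<integral>\<^sup>+s. \<integral>\<^sup>+U. ?f s * ?g (receiver ori thr x e U) \<partial>mark_law \<partial>exp_law)"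
      by (subst U.nn_integral_fst[symmetric]) auto
    also have "\<dots> = (\<integral>\<^sup>+s. ?f s * (\<integral>\<^sup>+U. ?g (receiver ori thr x e U) \<partial>mark_law) \<partial>exp_law)"
      by (intro nn_integral_cong nn_integral_cmult) measurable
    also have "\<dots> = ?A * (\<integral>\<^sup>+U. ?g (receiver ori thr x e U) \<partial>mark_law)"
      by (rule nn_integral_multc) measurable
    finally show "(\<integral>\<^sup>+X. indicator {X. first_ring E e X} X * \<Psi> e (X (e, 0), after_ring E e X) \<partial>noise E) =
      ?A * (\<integral>\<^sup>+U. ?g (receiver ori thr x e U) \<partial>mark_law)" .
  qed
  also have "\<dots> = ?A * of_nat (card E) * (\<integral>\<^sup>+w. ?g w \<partial>recv x)"
    by (simp only: sum_distrib_left[symmetric] nn_integral_recv[of ?g x] mult.assoc)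
  also have "\<dots> = ennreal (pmf (poisson_law (?m * t)) (Suc n)) * ennreal (pmf (jumps (Suc n) x) y)"
    using nn_integral_first_ring_time[OF Suc.prems, of n] by (simp add: ennreal_pmf_bind)
  finally show ?case .
qed

text \<open>Only the domination of \<^term>\<open>trans t x\<close> by the law of the load is shown directly; equality
  follows since both have total mass one.
  In particular it need not be shown that the exceptional set in \<^const>\<open>rings\<close> is null.\<close>
lemma distr_load:
  assumes t: "0 \<le> t"
  shows "distr (noise E) (count_space UNIV) (load E ori thr t x) = measure_pmf (trans t x)"
proof -
  let ?D = "distr (noise E) (count_space UNIV) (load E ori thr t x)"
  interpret noise: prob_space "noise E" by (rule prob_space_noise)
  interpret D: prob_space ?D by (rule noise.prob_space_distr) (rule measurable_load)
  have single: "emeasure (trans t x) {y} \<le> emeasure ?D {y}" for y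
  proof -
    have arr: "arrival E ori thr y n t x \<in> borel_measurable (noise E)" for n
      using measurable_Pair2[OF measurable_arrival, of t] by simp
    have "emeasure (trans t x) {y} = (\<integral>\<^sup>+n. ennreal (pmf (jumps n x) y) \<partial>poisson_law (real (card E) * t))"
      by (simp add: emeasure_pmf_single trans_def ennreal_pmf_bind)
    also have "\<dots> = (\<Sum>n. \<integral>\<^sup>+X. arrival E ori thr y n t x X \<partial>noise E)"
      by (simp add: nn_integral_measure_pmf nn_integral_count_space_nat nn_integral_arrival t mult.commute)
    also have "\<dots> = (\<integral>\<^sup>+X. (\<Sum>n. arrival E ori thr y n t x X) \<partial>noise E)"
      using arr by (rule nn_integral_suminf[symmetric])
    also have "\<dots> \<le> (\<integral>\<^sup>+X. indicator {y} (load E ori thr t x X) \<partial>noise E)"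
    proof (rule nn_integral_mono_AE)
      show "AE X in noise E. (\<Sum>n. arrival E ori thr y n t x X) \<le> indicator {y} (load E ori thr t x X)"
        using AE_noise_pos[of E] by eventually_elim (rule suminf_arrival_le)
    qed
    also have "\<dots> = (\<integral>\<^sup>+z. indicator {y} z \<partial>?D)"
      by (subst nn_integral_distr) (auto intro: measurable_load)
    also have "\<dots> = emeasure ?D {y}" by simp
    finally show ?thesis .
  qed
  have le: "emeasure (trans t x) A \<le> emeasure ?D A" for A
    using single by (subst (1 2) emeasure_countable_singleton) (auto intro!: nn_integral_mono countableI_type)
  show ?thesis
  proof (rule measure_eqI)
    fix A
    have "emeasure ?D A \<le> emeasure (trans t x) A"
    proof -
      have "measure (trans t x) (- A) \<le> measure ?D (- A)"
        using le[of "- A"] by (simp add: D.emeasure_eq_measure measure_pmf.emeasure_eq_measure)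
      then have "measure ?D A \<le> measure (trans t x) A"
        using D.prob_compl[of A] measure_pmf.prob_compl[of A "trans t x"] by (simp add: Compl_eq_Diff_UNIV)
      then show ?thesis by (simp add: D.emeasure_eq_measure measure_pmf.emeasure_eq_measure)
    qed
    then show "emeasure ?D A = emeasure (trans t x) A" using le by (simp add: order_antisym)
  qed simp
qed

end

section \<open>Dissipation of the energy\<close>

lemma integrable_pmf_bounded:
  fixes f :: "'a \<Rightarrow> real"
  assumes "\<And>x. \<bar>f x\<bar> \<le> B" shows "integrable (measure_pmf p) f"
  using assms by (intro measure_pmf.integrable_const_bound[where B=B]) auto

lemma expectation_bind_pmf:
  fixes f :: "'a \<Rightarrow> real"
  assumes "\<And>x. \<bar>f x\<bar> \<le> B"
  shows "measure_pmf.expectation (bind_pmf p g) f =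
    measure_pmf.expectation p (\<lambda>x. measure_pmf.expectation (g x) f)"
  unfolding measure_pmf_bind using assms
  by (intro integral_bind[where K="count_space UNIV" and B=B and B'=1])
    (auto simp: measure_pmf_in_subprob_algebra measure_pmf.emeasure_space_1)

lemma abs_expectation_le:
  fixes f :: "'a \<Rightarrow> real"
  assumes "\<And>x. \<bar>f x\<bar> \<le> B"
  shows "\<bar>measure_pmf.expectation p f\<bar> \<le> B"
proof -
  have "\<bar>measure_pmf.expectation p f\<bar> \<le> measure_pmf.expectation p (\<lambda>x. \<bar>f x\<bar>)"
    by (rule integral_abs_bound)
  also have "\<dots> \<le> measure_pmf.expectation p (\<lambda>_. B)"
    using assms by (intro integral_mono integrable_pmf_bounded[where B=B]) (auto intro: order_trans[OF abs_ge_zero])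
  finally show ?thesis by simp
qed

lemma expectation_square_ge:
  fixes f :: "'a \<Rightarrow> real"
  assumes "\<And>x. \<bar>f x\<bar> \<le> B"
  shows "(measure_pmf.expectation p f)\<^sup>2 \<le> measure_pmf.expectation p (\<lambda>x. (f x)\<^sup>2)"
    and "measure_pmf.expectation p (\<lambda>x. (f x)\<^sup>2) - (measure_pmf.expectation p f)\<^sup>2 =
      measure_pmf.expectation p (\<lambda>x. (f x - measure_pmf.expectation p f)\<^sup>2)"
proof -
  let ?c = "measure_pmf.expectation p f"
  have f: "integrable p f" using assms by (rule integrable_pmf_bounded)
  have "\<bar>(f x)\<^sup>2\<bar> \<le> B\<^sup>2" for x
    using assms[of x] power_mono[of "\<bar>f x\<bar>" B 2] by simp
  then have f2: "integrable p (\<lambda>x. (f x)\<^sup>2)" by (rule integrable_pmf_bounded)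
  have "measure_pmf.expectation p (\<lambda>x. (f x - ?c)\<^sup>2) =
      measure_pmf.expectation p (\<lambda>x. (f x)\<^sup>2 - 2 * ?c * f x + ?c\<^sup>2)"
    by (simp add: power2_diff algebra_simps)
  also have "\<dots> = measure_pmf.expectation p (\<lambda>x. (f x)\<^sup>2) - ?c\<^sup>2"
    using f f2 by (simp add: power2_eq_square)
  finally show var: "measure_pmf.expectation p (\<lambda>x. (f x)\<^sup>2) - ?c\<^sup>2 =
      measure_pmf.expectation p (\<lambda>x. (f x - ?c)\<^sup>2)" by simp
  have "0 \<le> measure_pmf.expectation p (\<lambda>x. (f x - ?c)\<^sup>2)"
    by (rule integral_nonneg_AE) simp
  then show "?c\<^sup>2 \<le> measure_pmf.expectation p (\<lambda>x. (f x)\<^sup>2)" using var by linarith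
qed

lemma expectation_finite:
  fixes f :: "'a::finite \<Rightarrow> real"
  shows "measure_pmf.expectation p f = (\<Sum>x\<in>UNIV. pmf p x * f x)"
  by (subst integral_measure_pmf[where A=UNIV]) auto

text \<open>Multiplied by \<open>u + v\<close>, the difference of the two sides is a perfect square,
  which vanishes when \<open>c\<close> is the weighted mean of \<open>x\<close> and
  \<open>y\<close>.\<close>

lemma weighted_two_point_variance:
  fixes x y c u v :: real
  assumes "0 \<le> u" "0 < v"
  shows "u * v / (u + v) * (x - y)\<^sup>2 \<le> u * (x - c)\<^sup>2 + v * (y - c)\<^sup>2"
proof -
  have "(u + v) * (u * (x - c)\<^sup>2 + v * (y - c)\<^sup>2) - u * v * (x - y)\<^sup>2 = (u * (x - c) + v * (y - c))\<^sup>2"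
    by (simp add: power2_eq_square algebra_simps)
  then have "u * v * (x - y)\<^sup>2 \<le> (u + v) * (u * (x - c)\<^sup>2 + v * (y - c)\<^sup>2)"
    by (smt (verit) zero_le_power2)
  then show ?thesis using assms by (simp add: divide_le_eq mult.commute mult.left_commute)
qed

context local_rule
begin

text \<open>Nonnegativity of \<open>g\<close> lets all terms of the Poisson mixture except
  \<open>n = 0\<close> and \<open>n = 1\<close> be dropped. This serves the variance bound as well
  as the comparison of overflow at two times.\<close>

lemma expectation_trans_ge:
  assumes h: "0 \<le> h" and g: "\<And>y. 0 \<le> g y" "\<And>y. g y \<le> B"
  shows "exp (- (real (card E) * h)) *
      (g x + real (card E) * h * measure_pmf.expectation (recv x) (\<lambda>w. g (add_ball x w)))
    \<le> measure_pmf.expectation (trans h x) g"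
proof -
  let ?P = "poisson_law (real (card E) * h)"
  let ?F = "\<lambda>n. measure_pmf.expectation (jumps n x) g"
  have gB: "\<bar>g y\<bar> \<le> B" for y using g[of y] by simp
  have F: "\<bar>?F n\<bar> \<le> B" "0 \<le> ?F n" for n
    using abs_expectation_le[OF gB, of "jumps n x"] g(1) by (auto intro!: integral_nonneg_AE)
  have F0: "?F 0 = g x" by simp
  have F1: "?F (Suc 0) = measure_pmf.expectation (recv x) (\<lambda>w. g (add_ball x w))"
    by (simp add: expectation_bind_pmf[OF gB])
  have "measure_pmf.expectation ?P (\<lambda>n. ?F n * indicator {0, Suc 0} n) =
      (\<Sum>n\<in>{0, Suc 0}. pmf ?P n *\<^sub>R (?F n * indicator {0, Suc 0} n))"
    by (rule integral_measure_pmf) (auto simp: indicator_def split: if_splits)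
  also have "\<dots> = exp (- (real (card E) * h)) * (?F 0 + real (card E) * h * ?F (Suc 0))"
    using h by (simp add: pmf_poisson_law algebra_simps)
  finally have "exp (- (real (card E) * h)) * (?F 0 + real (card E) * h * ?F (Suc 0)) =
      measure_pmf.expectation ?P (\<lambda>n. ?F n * indicator {0, Suc 0} n)" ..
  also have "\<dots> \<le> measure_pmf.expectation ?P ?F"
  proof (rule integral_mono)
    have "\<bar>?F n * indicator {0, Suc 0} n\<bar> \<le> B" for n
      using F[of n] by (auto simp: indicator_def)
    then show "integrable ?P (\<lambda>n. ?F n * indicator {0, Suc 0} n)" by (rule integrable_pmf_bounded)
    show "integrable ?P ?F" using F(1) by (rule integrable_pmf_bounded)
  qed (use F(2) in \<open>auto simp: indicator_def\<close>)
  also have "\<dots> = measure_pmf.expectation (trans h x) g"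
    unfolding trans_def by (rule expectation_bind_pmf[OF gB, symmetric])
  finally show ?thesis unfolding F0 F1 .
qed

text \<open>Up to the common factor \<open>exp (- a)\<close>, the profiles after no ring and after
  one ring have weights \<open>1\<close> and \<open>a\<close>. Squared deviations from the mean at
  these two places already control the increment between them.\<close>

lemma variance_trans_ge:
  assumes h: "0 \<le> h" and k: "\<And>y. \<bar>k y\<bar> \<le> B"
  shows "real (card E) * h * exp (- (2 * real (card E) * h)) *
      measure_pmf.expectation (recv x) (\<lambda>w. (k (add_ball x w) - k x)\<^sup>2)
    \<le> measure_pmf.expectation (trans h x) (\<lambda>y. (k y)\<^sup>2) - (measure_pmf.expectation (trans h x) k)\<^sup>2"
proof -
  define a where "a = real (card E) * h"
  have a: "0 \<le> a" using h by (simp add: a_def)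
  define c where "c = measure_pmf.expectation (trans h x) k"
  have c: "\<bar>c\<bar> \<le> B" unfolding c_def using k by (rule abs_expectation_le)
  have bound: "(k y - c)\<^sup>2 \<le> (2 * B)\<^sup>2" for y
  proof -
    have "\<bar>k y - c\<bar> \<le> 2 * B" using k[of y] c by linarith
    from power_mono[OF this, of 2] show ?thesis by simp
  qed
  note ge = expectation_trans_ge[OF h zero_le_power2 bound, folded a_def, where x=x]
  let ?S = "measure_pmf.expectation (recv x)"
  \<comment> \<open>The weights \<open>1\<close> and \<open>a\<close> combine to
    \<open>a / (a + 1)\<close>. Bounding \<open>1 / (a + 1)\<close> below by
    \<open>exp (- a)\<close> produces the second exponential factor.\<close>
  have "a * exp (- (2 * a)) \<le> exp (- a) * (a / (a + 1))"
  proof -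
    have "exp (- (2 * a)) = exp (- a) * exp (- a)" by (simp add: exp_add[symmetric])
    moreover have "exp (- a) \<le> 1 / (a + 1)"
      using exp_ge_add_one_self[of a] a by (simp add: exp_minus field_simps)
    ultimately have "exp (- (2 * a)) \<le> exp (- a) * (1 / (a + 1))"
      by (simp only:) (intro mult_left_mono, simp_all)
    from mult_left_mono[OF this a] show ?thesis by (simp add: mult_ac)
  qed
  moreover have "0 \<le> ?S (\<lambda>w. (k (add_ball x w) - k x)\<^sup>2)" by (rule integral_nonneg_AE) simp
  ultimately have "a * exp (- (2 * a)) * ?S (\<lambda>w. (k (add_ball x w) - k x)\<^sup>2) \<le>
      exp (- a) * (a / (a + 1)) * ?S (\<lambda>w. (k (add_ball x w) - k x)\<^sup>2)"
    by (rule mult_right_mono)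
  also have "\<dots> = exp (- a) * ?S (\<lambda>w. a * 1 / (a + 1) * (k (add_ball x w) - k x)\<^sup>2)"
    by simp
  also have "\<dots> \<le> exp (- a) * ?S (\<lambda>w. a * (k (add_ball x w) - c)\<^sup>2 + 1 * (k x - c)\<^sup>2)"
    using weighted_two_point_variance[OF a, of 1]
    by (intro mult_left_mono integral_mono integrable_measure_pmf_finite) auto
  also have "?S (\<lambda>w. a * (k (add_ball x w) - c)\<^sup>2 + 1 * (k x - c)\<^sup>2) =
      (k x - c)\<^sup>2 + a * ?S (\<lambda>w. (k (add_ball x w) - c)\<^sup>2)"
    by (simp add: integrable_measure_pmf_finite)
  also note ge
  also have "measure_pmf.expectation (trans h x) (\<lambda>y. (k y - c)\<^sup>2) =
      measure_pmf.expectation (trans h x) (\<lambda>y. (k y)\<^sup>2) - c\<^sup>2"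
    unfolding c_def by (rule expectation_square_ge(2)[symmetric, OF k])
  finally show ?thesis by (simp add: a_def c_def mult.assoc)
qed

end

section \<open>Truncated differences under one added ball\<close>

lemma abs_gap_le: "\<bar>x i - x j\<bar> \<le> gap x"
proof -
  have "x k \<le> Max (range x)" "Min (range x) \<le> x k" for k by simp_all
  from this[of i] this[of j] show ?thesis unfolding gap_def by linarith
qed

lemma measurable_tag: "tag E ori thr t x v \<in> noise E \<rightarrow>\<^sub>M count_space UNIV"
proof -
  have inner: "(\<lambda>X. THE w. y = add_ball (load E ori thr t x X) w) \<in> noise E \<rightarrow>\<^sub>M count_space UNIV" for y
    by (rule measurable_compose[OF measurable_load]) simp
  have "(\<lambda>X. THE w. load E ori thr t (add_ball x v) X = add_ball (load E ori thr t x X) w)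
      \<in> noise E \<rightarrow>\<^sub>M count_space UNIV"
    by (rule measurable_compose_countable[where f="\<lambda>y X. THE w. y = add_ball (load E ori thr t x X) w",
          OF inner measurable_load])
  then show ?thesis by (simp add: tag_def[abs_def])
qed

definition clamp :: "real \<Rightarrow> real \<Rightarrow> real" where
  "clamp M z = max (- M) (min M z)"

lemma abs_clamp_le: "0 \<le> M \<Longrightarrow> \<bar>clamp M z\<bar> \<le> M"
  by (auto simp: clamp_def)

definition clamped_diff :: "real \<Rightarrow> ('v \<Rightarrow> 'v) \<Rightarrow> 'v \<Rightarrow> ('v \<Rightarrow> int) \<Rightarrow> real" where
  "clamped_diff M \<psi> i x = clamp M (of_int (x i - x (\<psi> i)))"

text \<open>A gap of at most \<open>M - 1\<close> leaves room for one ball below the truncation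
  level, so the full unit is seen; in general only monotonicity of the truncation remains.\<close>

lemma clamped_diff_add_ball_self:
  fixes x :: "'v::finite \<Rightarrow> int"
  assumes "\<psi> i \<noteq> i" "1 \<le> M"
  shows "0 \<le> clamped_diff M \<psi> i (add_ball x i) - clamped_diff M \<psi> i x"
    and "of_int (gap x) \<le> M - 1 \<Longrightarrow> clamped_diff M \<psi> i (add_ball x i) - clamped_diff M \<psi> i x = 1"
proof -
  show "0 \<le> clamped_diff M \<psi> i (add_ball x i) - clamped_diff M \<psi> i x"
    using assms by (auto simp: clamped_diff_def clamp_def add_ball_def)
  assume "of_int (gap x) \<le> M - 1"
  moreover have "real_of_int \<bar>x i - x (\<psi> i)\<bar> \<le> of_int (gap x)"
    using abs_gap_le[of x i "\<psi> i"] by (simp only: of_int_le_iff)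
  ultimately have "\<bar>real_of_int (x i - x (\<psi> i))\<bar> \<le> M - 1" by simp
  then show "clamped_diff M \<psi> i (add_ball x i) - clamped_diff M \<psi> i x = 1"
    using assms by (auto simp: clamped_diff_def clamp_def add_ball_def)
qed

lemma clamped_diff_add_ball_partner:
  assumes "\<psi> i \<noteq> i" "1 \<le> M"
  shows "- 1 \<le> clamped_diff M \<psi> i (add_ball x (\<psi> i)) - clamped_diff M \<psi> i x"
  using assms by (auto simp: clamped_diff_def clamp_def add_ball_def)

lemma clamped_diff_add_ball_other:
  "j \<noteq> i \<Longrightarrow> j \<noteq> \<psi> i \<Longrightarrow> clamped_diff M \<psi> i (add_ball x j) = clamped_diff M \<psi> i x"
  by (simp add: clamped_diff_def add_ball_def)

text \<open>The ball put at \<open>j\<close> lowers only the difference of the \<open>i\<close> with \<open>\<psi> i = j\<close>, and that \<open>i\<close> lies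
  outside the ball around \<open>w\<close> as long as \<open>j\<close> is close to \<open>w\<close>.\<close>
lemma sum_clamped_diff_ge:
  fixes x :: "'v::finite \<Rightarrow> int"
  assumes d: "pseudometric d" and \<psi>: "bij \<psi>" and M: "1 \<le> M" and r: "0 < r"
    and far: "\<And>i. d i (\<psi> i) \<ge> 2 * r"
  shows "1 - of_bool (of_int (gap x) > M - 1) - 2 * of_bool (d j w \<ge> r) \<le>
    (\<Sum>i\<in>pball d w r. clamped_diff M \<psi> i (add_ball x j) - clamped_diff M \<psi> i x)"
proof -
  define D where "D i = clamped_diff M \<psi> i (add_ball x j) - clamped_diff M \<psi> i x" for i
  \<comment> \<open>A fixed point would have \<open>d i i = 0 < 2 * r\<close>.\<close>
  have ne: "\<psi> i \<noteq> i" for i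
    using far[of i] r d by (auto simp: pseudometric_def)
  define i' where "i' = inv \<psi> j"
  have i': "\<psi> i = j \<longleftrightarrow> i = i'" for i
    using \<psi> by (auto simp: i'_def bij_inv_eq_iff bij_is_inj inv_f_eq)
  have D: "D i \<ge> of_bool (i = j) * of_bool (of_int (gap x) \<le> M - 1) - of_bool (i = i')" for i
    using clamped_diff_add_ball_self[where \<psi>=\<psi> and i=i and M=M and x=x, OF ne M]
      clamped_diff_add_ball_partner[where \<psi>=\<psi> and i=i and M=M and x=x, OF ne M]
      clamped_diff_add_ball_other[of j i \<psi> M x] i'[of i] ne[of i]
    by (cases "i = j"; cases "i = i'") (auto simp: D_def)
  \<comment> \<open>When the tag is far, the left side is at most \<open>- 1\<close>, which covers
    the partner's decrement without any gain at the tag: this is where the factor \<open>2\<close>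
    comes from.\<close>
  have "1 - of_bool (of_int (gap x) > M - 1) - 2 * of_bool (d j w \<ge> r) \<le>
      of_bool (j \<in> pball d w r) * of_bool (of_int (gap x) \<le> M - 1) - (of_bool (i' \<in> pball d w r) :: real)"
  proof (cases "d j w \<ge> r")
    case False
    have dsym: "d a b = d b a" and tri: "d a c \<le> d a b + d b c" for a b c
      using d by (auto simp: pseudometric_def)
    have "j \<in> pball d w r" using False dsym[of j w] by (simp add: pball_def)
    moreover have "i' \<notin> pball d w r"
    proof
      assume "i' \<in> pball d w r"
      then have "d i' w \<le> r" using dsym by (simp add: pball_def)
      moreover have "d i' j \<ge> 2 * r" using far[of i'] i'[of i'] by simp
      ultimately show False using tri[of i' j w] dsym[of j w] False by linarith
    qed
    ultimately show ?thesis using False by auto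
  qed auto
  also have "\<dots> = (\<Sum>i\<in>pball d w r. of_bool (i = j) * of_bool (of_int (gap x) \<le> M - 1) - of_bool (i = i'))"
    unfolding sum_subtractf sum_distrib_right[symmetric] by simp
  also have "\<dots> \<le> (\<Sum>i\<in>pball d w r. D i)" by (rule sum_mono) (rule D)
  finally show ?thesis by (simp add: D_def)
qed

text \<open>The decrements are averaged over the starting point, since the loss rate is only known to
  be integrable.\<close>
lemma integral_loss_le:
  fixes G \<phi> :: "real \<Rightarrow> real"
  assumes T: "0 \<le> T" and anti: "antimono_on {0..T} G" and G0: "\<And>r. r \<in> {0..T} \<Longrightarrow> 0 \<le> G r"
    and \<phi>: "\<phi> integrable_on {0..T}"
    and a: "(a \<longlongrightarrow> a0) (at_right 0)" and \<epsilon>: "(\<epsilon> \<longlongrightarrow> 0) (at_right 0)"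
    and dec: "\<And>r h. 0 \<le> r \<Longrightarrow> 0 < h \<Longrightarrow> r + h \<le> T \<Longrightarrow> h * a h * (\<phi> r - \<epsilon> h) \<le> G r - G (r + h)"
  shows "a0 * integral {0..T} \<phi> \<le> G 0"
proof (cases "T = 0")
  case True
  then show ?thesis using G0[of 0] by simp
next
  case False
  then have T: "0 < T" using T by simp
  have intG: "G integrable_on {u..v}" if "0 \<le> u" "v \<le> T" for u v
  proof (rule integrable_subinterval_real)
    have "mono_on {0..T} (\<lambda>r. - G r)"
      using anti by (auto simp: monotone_on_def)
    then have "(\<lambda>r. - G r) integrable_on {0..T}" by (rule integrable_on_mono_on)
    then show "G integrable_on {0..T}" by (simp add: integrable_neg_iff)
  qed (use that in auto)
  have le: "a h * (integral {0..T - h} \<phi> - (T - h) * \<epsilon> h) \<le> G 0" if h: "0 < h" "h < T" for h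
  proof -
    have i\<phi>: "\<phi> integrable_on {0..T - h}"
      by (rule integrable_subinterval_real[OF \<phi>]) (use h in auto)
    have shift: "((\<lambda>r. G (r + h)) has_integral integral {h..T} G) {0..T - h}"
      using has_integral_affinity'[of G "integral {h..T} G" h T 1 h] intG[of h T] h
      by (simp add: has_integral_integral)
    have "h * (a h * (integral {0..T - h} \<phi> - (T - h) * \<epsilon> h)) =
        integral {0..T - h} (\<lambda>r. h * a h * (\<phi> r - \<epsilon> h))"
    proof -
      have "integral {0..T - h} (\<lambda>r. \<phi> r - \<epsilon> h) = integral {0..T - h} \<phi> - (T - h) * \<epsilon> h"
        using h i\<phi> by (subst integral_diff) auto
      then show ?thesis by (simp only: integral_mult_right mult.assoc)
    qed
    also have "\<dots> \<le> integral {0..T - h} (\<lambda>r. G r - G (r + h))"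
      using h i\<phi> intG[of 0 "T - h"] shift dec[of _ h]
      by (intro integral_le integrable_on_mult_right integrable_diff) (auto intro: has_integral_integrable)
    also have "\<dots> = integral {0..T - h} G - integral {h..T} G"
      using intG[of 0 "T - h"] shift h by (subst integral_diff) (auto simp: integral_unique)
    \<comment> \<open>The common middle part cancels. The piece left at the end is nonnegative, and
      the piece left at the start is at most \<open>h * G 0\<close>.\<close>
    also have "\<dots> = integral {0..h} G - integral {T - h..T} G"
      using Henstock_Kurzweil_Integration.integral_combine[of 0 h T G]
        Henstock_Kurzweil_Integration.integral_combine[of 0 "T - h" T G] intG[of 0 T] h by simp
    also have "\<dots> \<le> integral {0..h} G"
      using G0 h intG[of "T - h" T] by (auto intro: Henstock_Kurzweil_Integration.integral_nonneg)
    also have "\<dots> \<le> integral {0..h} (\<lambda>_. G 0)"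
      using intG[of 0 h] h anti by (intro integral_le) (auto simp: monotone_on_def)
    also have "\<dots> = h * G 0" using h by simp
    finally show ?thesis using h by simp
  qed
  have "((\<lambda>h. a h * (integral {0..T - h} \<phi> - (T - h) * \<epsilon> h)) \<longlongrightarrow>
      a0 * (integral {0..T - 0} \<phi> - (T - 0) * 0)) (at_right 0)"
  proof (intro tendsto_intros a \<epsilon>)
    \<comment> \<open>Indefinite integrals are continuous for every integrable
      \<open>\<phi>\<close>, so the limit asks for no further regularity.\<close>
    have cont: "continuous_on {0..T} (\<lambda>u. integral {0..u} \<phi>)"
      using \<phi> by (rule indefinite_integral_continuous_1)
    have "continuous_on {0..T} (\<lambda>h. integral {0..T - h} \<phi>)"
      by (rule continuous_on_compose2[OF cont]) (auto intro!: continuous_intros)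
    then have "((\<lambda>h. integral {0..T - h} \<phi>) \<longlongrightarrow> integral {0..T - 0} \<phi>) (at 0 within {0..T})"
      unfolding continuous_on_def by (rule bspec) (use T in simp)
    then show "((\<lambda>h. integral {0..T - h} \<phi>) \<longlongrightarrow> integral {0..T - 0} \<phi>) (at_right 0)"
      using T by (simp add: at_within_Icc_at_right)
  qed
  moreover have "eventually (\<lambda>h. a h * (integral {0..T - h} \<phi> - (T - h) * \<epsilon> h) \<le> G 0) (at_right 0)"
    using eventually_at_right_less[of 0] eventually_at_rightI[of 0 T "\<lambda>h. h < T"] T
    by (auto elim!: eventually_elim2 intro: le)
  ultimately have "a0 * (integral {0..T - 0} \<phi> - (T - 0) * 0) \<le> G 0"
    by (rule tendsto_upperbound) simp
  then show ?thesis by simp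
qed

text \<open>Jensen for the convex function \<open>[u]_+^2\<close>. The positive part is taken before
  squaring because the lower bound \<open>c\<close> may be negative.\<close>

lemma expectation_pos_part_square:
  fixes f :: "'a \<Rightarrow> real"
  assumes f: "\<And>x. \<bar>f x\<bar> \<le> B" and c: "c \<le> measure_pmf.expectation p f"
  shows "(max 0 c)\<^sup>2 \<le> measure_pmf.expectation p (\<lambda>x. (max 0 (f x))\<^sup>2)"
proof -
  have bound: "\<bar>max 0 (f x)\<bar> \<le> B" for x using f[of x] by linarith
  have "measure_pmf.expectation p f \<le> measure_pmf.expectation p (\<lambda>x. max 0 (f x))"
    by (intro integral_mono integrable_pmf_bounded[OF f] integrable_pmf_bounded[OF bound]) simp
  moreover have "0 \<le> measure_pmf.expectation p (\<lambda>x. max 0 (f x))"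
    by (rule integral_nonneg_AE) simp
  ultimately have "max 0 c \<le> measure_pmf.expectation p (\<lambda>x. max 0 (f x))" using c by simp
  then have "(max 0 c)\<^sup>2 \<le> (measure_pmf.expectation p (\<lambda>x. max 0 (f x)))\<^sup>2"
    by (rule power_mono) simp
  also have "\<dots> \<le> measure_pmf.expectation p (\<lambda>x. (max 0 (f x))\<^sup>2)"
    by (rule expectation_square_ge(1)[OF bound])
  finally show ?thesis .
qed

lemma card_pball_le: "card (pball d v r) \<le> max_ball_card d r" for v :: "'v::finite"
  unfolding max_ball_card_def by simp

lemma max_ball_card_pos:
  fixes d :: "'v::finite \<Rightarrow> 'v \<Rightarrow> real"
  assumes "pseudometric d" "0 \<le> r" shows "0 < max_ball_card d r"
proof -
  fix v :: 'v
  have "v \<in> pball d v r" using assms by (simp add: pball_def pseudometric_def)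
  then have "0 < card (pball d v r)" by (auto simp: card_gt_0_iff)
  then show ?thesis using card_pball_le[of d v r] by linarith
qed

section \<open>Between the semigroup and path probabilities\<close>

context local_rule
begin

text \<open>The energy lives on the semigroup, but comparing two starting profiles needs both copies
  on one noise; this is the passage between the two sides.\<close>

lemma integral_noise_load:
  fixes f :: "('v \<Rightarrow> int) \<Rightarrow> real"
  assumes "0 \<le> r"
  shows "measure_pmf.expectation (trans r x) f = (\<integral>X. f (load E ori thr r x X) \<partial>noise E)"
  unfolding distr_load[OF assms, symmetric] by (rule integral_distr[OF measurable_load]) simp

lemma integrable_noise_bounded:
  fixes f :: "'b \<Rightarrow> real"
  assumes "g \<in> noise E \<rightarrow>\<^sub>M count_space UNIV" "\<And>y. \<bar>f y\<bar> \<le> B"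
  shows "integrable (noise E) (\<lambda>X. f (g X))"
proof -
  interpret noise: prob_space "noise E" by (rule prob_space_noise)
  show ?thesis
    using assms by (intro noise.integrable_const_bound[where B=B] measurable_compose[OF assms(1)]) auto
qed

lemma load_add_ball: "load E ori thr t (add_ball x v) X = add_ball (load E ori thr t x X) (tag E ori thr t x v X)"
  unfolding tag_def by (rule theI'[OF tag_unique[OF rule graph]])

text \<open>Since \<open>recv x\<close> is the Palm law, averaging the probabilities for fixed
  starting vertices gives the quantity that \<open>q\<close> bounds.\<close>

lemma expectation_palm:
  "(\<Sum>w\<in>UNIV. pmf (recv x) w * (\<integral>X. of_bool (d (tag E ori thr s x w X) w \<ge> r) \<partial>noise E)) =
    \<P>((J\<^sub>0, X) in palm_space E ori thr x. d (tag E ori thr s x J\<^sub>0 X) J\<^sub>0 \<ge> r)"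
proof -
  interpret noise: prob_space "noise E" by (rule prob_space_noise)
  interpret pair_prob_space "measure_pmf (recv x)" "noise E" ..
  let ?A = "{(J\<^sub>0, X). (J\<^sub>0, X) \<in> space (measure_pmf (recv x) \<Otimes>\<^sub>M noise E) \<and>
      d (tag E ori thr s x J\<^sub>0 X) J\<^sub>0 \<ge> r}"
  have sec: "{X \<in> space (noise E). d (tag E ori thr s x w X) w \<ge> r} \<in> sets (noise E)" for w
  proof -
    have "Measurable.pred (noise E) (\<lambda>X. d (tag E ori thr s x w X) w \<ge> r)"
      by (rule measurable_compose[OF measurable_tag]) simp
    then show ?thesis by (simp add: pred_def)
  qed
  have "?A = (\<Union>w\<in>UNIV. {w} \<times> {X \<in> space (noise E). d (tag E ori thr s x w X) w \<ge> r})"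
    by (auto simp: space_pair_measure)
  also have "\<dots> \<in> sets (measure_pmf (recv x) \<Otimes>\<^sub>M noise E)"
    using sec by (intro sets.finite_UN pair_measureI) auto
  finally have A: "?A \<in> sets (measure_pmf (recv x) \<Otimes>\<^sub>M noise E)" .
  have "emeasure (measure_pmf (recv x) \<Otimes>\<^sub>M noise E) ?A =
      (\<integral>\<^sup>+w. emeasure (noise E) (Pair w -` ?A) \<partial>recv x)"
    by (rule noise.emeasure_pair_measure_alt[OF A])
  also have "\<dots> = (\<Sum>w\<in>UNIV. ennreal (measure (noise E) {X \<in> space (noise E). d (tag E ori thr s x w X) w \<ge> r}) *
      pmf (recv x) w)"
    by (subst nn_integral_measure_pmf_support[of UNIV])
      (auto simp: space_pair_measure vimage_def noise.emeasure_eq_measure)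
  also have "\<dots> = ennreal (\<Sum>w\<in>UNIV. pmf (recv x) w *
      measure (noise E) {X \<in> space (noise E). d (tag E ori thr s x w X) w \<ge> r})"
    by (simp add: sum_ennreal mult.commute flip: ennreal_mult)
  finally have "measure (measure_pmf (recv x) \<Otimes>\<^sub>M noise E) ?A = (\<Sum>w\<in>UNIV. pmf (recv x) w *
      measure (noise E) {X \<in> space (noise E). d (tag E ori thr s x w X) w \<ge> r})"
    by (simp add: measure_def sum_nonneg)
  moreover have "(\<integral>X. of_bool (d (tag E ori thr s x w X) w \<ge> r) \<partial>noise E) =
      measure (noise E) {X \<in> space (noise E). d (tag E ori thr s x w X) w \<ge> r}" for w
  proof -
    have "(\<integral>X. of_bool (d (tag E ori thr s x w X) w \<ge> r) \<partial>noise E) =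
        (\<integral>X. indicator {X \<in> space (noise E). d (tag E ori thr s x w X) w \<ge> r} X \<partial>noise E)"
      by (rule Bochner_Integration.integral_cong) (auto simp: indicator_def)
    also have "\<dots> = measure (noise E) {X \<in> space (noise E). d (tag E ori thr s x w X) w \<ge> r}"
      using sec[of w] by (subst Bochner_Integration.integral_indicator) (auto intro!: arg_cong[where f="measure (noise E)"])
    finally show ?thesis .
  qed
  ultimately show ?thesis by (simp add: palm_space_def palm_law_eq)
qed

lemma prob_process:
  assumes "0 \<le> t"
  shows "\<P>((x, X) in process_space E init. Q (load E ori thr t x X)) =
    measure_pmf.expectation (bind_pmf init (trans t)) (\<lambda>y. of_bool (Q y))"
proof -
  interpret noise: prob_space "noise E" by (rule prob_space_noise)
  interpret pair_prob_space "measure_pmf init" "noise E" ..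
  let ?A = "{(x, X). (x, X) \<in> space (measure_pmf init \<Otimes>\<^sub>M noise E) \<and> Q (load E ori thr t x X)}"
  have sec: "{X \<in> space (noise E). Q (load E ori thr t x X)} \<in> sets (noise E)" for x
  proof -
    have "Measurable.pred (noise E) (\<lambda>X. Q (load E ori thr t x X))"
      by (rule measurable_compose[OF measurable_load]) simp
    then show ?thesis by (simp add: pred_def)
  qed
  have "?A = (\<Union>x\<in>UNIV. {x} \<times> {X \<in> space (noise E). Q (load E ori thr t x X)})"
    by (auto simp: space_pair_measure)
  also have "\<dots> \<in> sets (measure_pmf init \<Otimes>\<^sub>M noise E)"
    using sec by (intro sets.countable_UN' pair_measureI) (auto intro: countableI_type)
  finally have A: "?A \<in> sets (measure_pmf init \<Otimes>\<^sub>M noise E)" .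
  have "emeasure (measure_pmf init \<Otimes>\<^sub>M noise E) ?A =
      (\<integral>\<^sup>+x. emeasure (noise E) (Pair x -` ?A) \<partial>init)"
    by (rule noise.emeasure_pair_measure_alt[OF A])
  also have "\<dots> = (\<integral>\<^sup>+x. emeasure (distr (noise E) (count_space UNIV) (load E ori thr t x)) {y. Q y} \<partial>init)"
  proof (rule nn_integral_cong)
    fix x
    have "Pair x -` ?A = load E ori thr t x -` {y. Q y} \<inter> space (noise E)"
      by (auto simp: space_pair_measure)
    then show "emeasure (noise E) (Pair x -` ?A) =
        emeasure (distr (noise E) (count_space UNIV) (load E ori thr t x)) {y. Q y}"
      by (simp add: emeasure_distr[OF measurable_load])
  qed
  also have "\<dots> = emeasure (bind_pmf init (trans t)) {y. Q y}"
    using assms by (simp add: distr_load)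
  finally have "measure (measure_pmf init \<Otimes>\<^sub>M noise E) ?A = measure (bind_pmf init (trans t)) {y. Q y}"
    by (simp add: measure_def)
  also have "\<dots> = measure_pmf.expectation (bind_pmf init (trans t)) (indicator {y. Q y})" by simp
  also have "indicator {y. Q y} = (\<lambda>y. of_bool (Q y) :: real)" by (auto simp: indicator_def)
  finally show ?thesis by (simp add: process_space_def)
qed

end

section \<open>Forecasts, energy and one short step\<close>

locale paired_rule = local_rule E ori thr
  for E :: "'v::finite set set" and ori thr +
  fixes d :: "'v \<Rightarrow> 'v \<Rightarrow> real" and \<psi> :: "'v \<Rightarrow> 'v" and M :: real
  assumes d: "pseudometric d" and \<psi>: "bij \<psi>" and M: "1 \<le> M"
begin

definition overflow :: "('v \<Rightarrow> int) \<Rightarrow> real" where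
  "overflow x = of_bool (of_int (gap x) > M - 1)"

definition forecast :: "real \<Rightarrow> 'v \<Rightarrow> ('v \<Rightarrow> int) \<Rightarrow> real" where
  "forecast r i x = measure_pmf.expectation (trans r x) (clamped_diff M \<psi> i)"

lemma abs_overflow_le: "\<bar>overflow x\<bar> \<le> 1"
  by (simp add: overflow_def)

lemma abs_clamped_diff_le: "\<bar>clamped_diff M \<psi> i x\<bar> \<le> M"
  unfolding clamped_diff_def using M by (intro abs_clamp_le) simp

lemma abs_forecast_le: "\<bar>forecast r i x\<bar> \<le> M"
  unfolding forecast_def by (rule abs_expectation_le) (rule abs_clamped_diff_le)

lemma forecast_add:
  assumes "0 \<le> r" "0 \<le> h"
  shows "forecast (r + h) i x = measure_pmf.expectation (trans h x) (forecast r i)"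
  using trans_add[OF assms(2,1), of x] expectation_bind_pmf[where p="trans h x" and g="trans r", OF abs_clamped_diff_le]
  by (simp add: forecast_def[abs_def] add.commute)

text \<open>Both forecasts are integrals over the same noise, so their difference is the mean
  increment caused by one ball placed at the tag, and the pathwise bound
  \<open>sum_clamped_diff_ge\<close> can be integrated.\<close>

lemma sum_forecast_ge:
  assumes s: "0 \<le> s" and r: "0 < r" and far: "\<And>i. d i (\<psi> i) \<ge> 2 * r"
  shows "1 - measure_pmf.expectation (trans s x) overflow
      - 2 * (\<integral>X. of_bool (d (tag E ori thr s x w X) w \<ge> r) \<partial>noise E) \<le>
    (\<Sum>i\<in>pball d w r. forecast s i (add_ball x w) - forecast s i x)"
proof -
  interpret noise: prob_space "noise E" by (rule prob_space_noise)
  let ?L = "load E ori thr s" and ?J = "tag E ori thr s x w"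
  note bnd = integrable_noise_bounded[OF measurable_load abs_clamped_diff_le]
  have int: "integrable (noise E) (\<lambda>X. overflow (?L x X))"
    by (rule integrable_noise_bounded[OF measurable_load abs_overflow_le])
  have int': "integrable (noise E) (\<lambda>X. of_bool (d (?J X) w \<ge> r) :: real)"
    using integrable_noise_bounded[OF measurable_tag, of "\<lambda>j. of_bool (d j w \<ge> r)" 1] by simp
  have "1 - measure_pmf.expectation (trans s x) overflow - 2 * (\<integral>X. of_bool (d (?J X) w \<ge> r) \<partial>noise E) =
      (\<integral>X. 1 - overflow (?L x X) - 2 * of_bool (d (?J X) w \<ge> r) \<partial>noise E)"
    using int int' by (simp add: integral_noise_load[OF s] noise.prob_space)
  also have "\<dots> \<le> (\<integral>X. (\<Sum>i\<in>pball d w r. clamped_diff M \<psi> i (?L (add_ball x w) X) - clamped_diff M \<psi> i (?L x X)) \<partial>noise E)"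
  proof (rule integral_mono)
    show "1 - overflow (?L x X) - 2 * of_bool (d (?J X) w \<ge> r) \<le>
        (\<Sum>i\<in>pball d w r. clamped_diff M \<psi> i (?L (add_ball x w) X) - clamped_diff M \<psi> i (?L x X))" for X
      unfolding load_add_ball overflow_def using far by (rule sum_clamped_diff_ge[OF d \<psi> M r])
    show "integrable (noise E) (\<lambda>X. 1 - overflow (?L x X) - 2 * of_bool (d (?J X) w \<ge> r))"
      using int int' by (intro Bochner_Integration.integrable_diff integrable_mult_right) auto
    show "integrable (noise E) (\<lambda>X. \<Sum>i\<in>pball d w r.
        clamped_diff M \<psi> i (?L (add_ball x w) X) - clamped_diff M \<psi> i (?L x X))"
      by (intro Bochner_Integration.integrable_sum Bochner_Integration.integrable_diff bnd)
  qed
  also have "\<dots> = (\<Sum>i\<in>pball d w r. forecast s i (add_ball x w) - forecast s i x)"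
    unfolding forecast_def integral_noise_load[OF s]
    by (subst Bochner_Integration.integral_sum) (auto intro!: sum.cong Bochner_Integration.integrable_diff
        Bochner_Integration.integral_diff bnd)
  finally show ?thesis .
qed

text \<open>For each receiver \<open>w\<close>, Cauchy-Schwarz on the ball around \<open>w\<close>
  turns the sum of increments into a sum of squares; averaging \<open>w\<close> over
  \<open>recv x\<close> is what brings in the Palm bound, by Jensen.\<close>

lemma sum_forecast_square_ge:
  assumes s: "0 \<le> s" and r: "0 < r" and far: "\<And>i. d i (\<psi> i) \<ge> 2 * r"
    and q: "\<P>((J\<^sub>0, \<omega>) in palm_space E ori thr x. d (tag E ori thr s x J\<^sub>0 \<omega>) J\<^sub>0 \<ge> r) \<le> q"
  shows "(max 0 (1 - measure_pmf.expectation (trans s x) overflow - 2 * q))\<^sup>2 / max_ball_card d r \<le>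
    (\<Sum>i\<in>UNIV. measure_pmf.expectation (recv x) (\<lambda>w. (forecast s i (add_ball x w) - forecast s i x)\<^sup>2))"
proof -
  define V where "V = real (max_ball_card d r)"
  have V: "0 < V" using max_ball_card_pos[OF d, of r] r by (simp add: V_def)
  define \<tau> :: "'v \<Rightarrow> real" where "\<tau> w = (\<integral>X. of_bool (d (tag E ori thr s x w X) w \<ge> r) \<partial>noise E)" for w
  define c where "c = 1 - measure_pmf.expectation (trans s x) overflow"
  define \<delta> where "\<delta> i w = forecast s i (add_ball x w) - forecast s i x" for i w
  have \<tau>: "measure_pmf.expectation (recv x) \<tau> \<le> q"
    using q unfolding expectation_palm[symmetric] expectation_finite \<tau>_def .
  define B where "B = Max (range (\<lambda>w. \<bar>c - 2 * \<tau> w\<bar>))"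
  have "(max 0 (c - 2 * q))\<^sup>2 \<le> measure_pmf.expectation (recv x) (\<lambda>w. (max 0 (c - 2 * \<tau> w))\<^sup>2)"
  proof (rule expectation_pos_part_square)
    show "\<bar>c - 2 * \<tau> w\<bar> \<le> B" for w unfolding B_def by (rule Max_ge) auto
    show "c - 2 * q \<le> measure_pmf.expectation (recv x) (\<lambda>w. c - 2 * \<tau> w)"
      using \<tau> by (simp add: integrable_measure_pmf_finite)
  qed
  also have "\<dots> \<le> measure_pmf.expectation (recv x) (\<lambda>w. V * (\<Sum>i\<in>UNIV. (\<delta> i w)\<^sup>2))"
  proof (rule integral_mono)
    fix w
    have "c - 2 * \<tau> w \<le> (\<Sum>i\<in>pball d w r. \<delta> i w)"
      unfolding c_def \<tau>_def \<delta>_def using far by (rule sum_forecast_ge[OF s r])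
    then have "max 0 (c - 2 * \<tau> w) \<le> \<bar>\<Sum>i\<in>pball d w r. \<delta> i w\<bar>" by linarith
    then have "(max 0 (c - 2 * \<tau> w))\<^sup>2 \<le> (\<Sum>i\<in>pball d w r. \<delta> i w)\<^sup>2"
      using power_mono[of "max 0 (c - 2 * \<tau> w)" "\<bar>\<Sum>i\<in>pball d w r. \<delta> i w\<bar>" 2] by simp
    also have "\<dots> \<le> (\<Sum>i\<in>pball d w r. 1\<^sup>2) * (\<Sum>i\<in>pball d w r. (\<delta> i w)\<^sup>2)"
      using Cauchy_Schwarz_ineq_sum[of "\<lambda>_. 1" "\<lambda>i. \<delta> i w"] by simp
    \<comment> \<open>Only now is the sum of squares enlarged to all vertices, so that it no longer
      depends on the ball; the factor remains the size of a ball.\<close>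
    also have "\<dots> \<le> V * (\<Sum>i\<in>UNIV. (\<delta> i w)\<^sup>2)"
      using card_pball_le[of d w r] V by (intro mult_mono sum_mono2 sum_nonneg) (auto simp: V_def)
    finally show "(max 0 (c - 2 * \<tau> w))\<^sup>2 \<le> V * (\<Sum>i\<in>UNIV. (\<delta> i w)\<^sup>2)" .
  qed (auto intro!: integrable_measure_pmf_finite)
  also have "\<dots> = V * (\<Sum>i\<in>UNIV. measure_pmf.expectation (recv x) (\<lambda>w. (\<delta> i w)\<^sup>2))"
    by (simp add: integrable_measure_pmf_finite)
  finally show ?thesis
    using V by (simp add: V_def c_def \<delta>_def divide_le_eq mult.commute)
qed

text \<open>For \<open>0 <= r <= t\<close>, \<open>forecast r i\<close> at the profile of time
  \<open>t - r\<close> is the conditional mean of the truncated difference at time \<open>t\<close>.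
  The energy thus measures what is predictable \<open>r\<close> time units ahead, and it decreases
  in \<open>r\<close>.\<close>

definition energy :: "('v \<Rightarrow> int) pmf \<Rightarrow> real \<Rightarrow> real \<Rightarrow> real" where
  "energy init t r = (\<Sum>i\<in>UNIV. measure_pmf.expectation (bind_pmf init (trans (t - r)))
     (\<lambda>x. (forecast r i x)\<^sup>2))"

lemma forecast_square_le: "\<bar>(forecast r i x)\<^sup>2\<bar> \<le> M\<^sup>2"
  using power_mono[OF abs_forecast_le, of r i x 2] by simp

lemma energy_nonneg: "0 \<le> energy init t r"
  unfolding energy_def by (intro sum_nonneg integral_nonneg_AE) simp

lemma energy_le: "energy init t r \<le> CARD('v) * M\<^sup>2"
proof -
  have "energy init t r \<le> (\<Sum>i\<in>(UNIV :: 'v set). M\<^sup>2)"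
    unfolding energy_def by (rule sum_mono) (rule abs_le_D1[OF abs_expectation_le[OF forecast_square_le]])
  then show ?thesis by simp
qed

text \<open>Given the profile at time \<open>t - (r + h)\<close>, the loss is the variance of
  \<open>forecast r i\<close> under \<open>trans h\<close>, by the semigroup law; the pointwise
  bounds are then averaged over that profile, with Jensen for the overflow term.\<close>

lemma energy_decrement:
  assumes r: "0 \<le> r" and h: "0 \<le> h" and t: "r + h \<le> t"
    and R: "0 < R" and far: "\<And>i. d i (\<psi> i) \<ge> 2 * R"
    and q: "\<And>x. \<P>((J\<^sub>0, \<omega>) in palm_space E ori thr x. d (tag E ori thr r x J\<^sub>0 \<omega>) J\<^sub>0 \<ge> R) \<le> q"
  shows "h * (real (card E) * exp (- (2 * real (card E) * h))) *
      ((max 0 (1 - measure_pmf.expectation (bind_pmf init (trans (t - h))) overflow - 2 * q))\<^sup>2 / max_ball_card d R)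
    \<le> energy init t r - energy init t (r + h)"
proof -
  define \<nu> where "\<nu> = bind_pmf init (trans (t - (r + h)))"
  define a where "a = real (card E) * h * exp (- (2 * real (card E) * h))"
  have a: "0 \<le> a" using h by (simp add: a_def)
  define V where "V = real (max_ball_card d R)"
  have V: "0 < V" using max_ball_card_pos[OF d, of R] R by (simp add: V_def)
  have step: "bind_pmf \<nu> (trans s) = bind_pmf init (trans (t - (r + h) + s))" if "0 \<le> s" for s
    using trans_add[of "t - (r + h)" s] t that by (simp add: \<nu>_def bind_assoc_pmf)
  let ?\<Gamma> = "\<lambda>x. measure_pmf.expectation (trans r x) overflow"
  let ?S = "\<lambda>i x. measure_pmf.expectation (recv x) (\<lambda>w. (forecast r i (add_ball x w) - forecast r i x)\<^sup>2)"
  let ?D = "\<lambda>i x. measure_pmf.expectation (trans h x) (\<lambda>y. (forecast r i y)\<^sup>2) - (forecast (r + h) i x)\<^sup>2"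
  have \<Gamma>: "\<bar>?\<Gamma> x\<bar> \<le> 1" for x by (rule abs_expectation_le) (rule abs_overflow_le)
  have S: "\<bar>?S i x\<bar> \<le> (2 * M)\<^sup>2" for i x
  proof (rule abs_expectation_le)
    fix w
    have "\<bar>forecast r i (add_ball x w) - forecast r i x\<bar> \<le> 2 * M"
      using abs_forecast_le[of r i x] abs_forecast_le[of r i "add_ball x w"] by linarith
    from power_mono[OF this, of 2]
    show "\<bar>(forecast r i (add_ball x w) - forecast r i x)\<^sup>2\<bar> \<le> (2 * M)\<^sup>2" by simp
  qed
  have intD: "integrable \<nu> (?D i)" for i
    by (intro Bochner_Integration.integrable_diff integrable_pmf_bounded[OF forecast_square_le]
        integrable_pmf_bounded[OF abs_expectation_le[OF forecast_square_le]])
  \<comment> \<open>Starting at time \<open>t - (r + h)\<close> and running for \<open>r\<close>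
    leads to time \<open>t - h\<close>, hence the overflow at \<open>t - h\<close>.\<close>
  have c: "1 - measure_pmf.expectation (bind_pmf init (trans (t - h))) overflow - 2 * q =
      measure_pmf.expectation \<nu> (\<lambda>x. 1 - ?\<Gamma> x - 2 * q)"
  proof -
    have "measure_pmf.expectation (bind_pmf init (trans (t - h))) overflow =
        measure_pmf.expectation \<nu> ?\<Gamma>"
      using step[OF r] expectation_bind_pmf[where p=\<nu> and g="trans r", OF abs_overflow_le] by (simp add: algebra_simps)
    then show ?thesis by (simp add: integrable_pmf_bounded[OF \<Gamma>])
  qed
  have "(max 0 (1 - measure_pmf.expectation (bind_pmf init (trans (t - h))) overflow - 2 * q))\<^sup>2 \<le>
      measure_pmf.expectation \<nu> (\<lambda>x. (max 0 (1 - ?\<Gamma> x - 2 * q))\<^sup>2)"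
  proof (rule expectation_pos_part_square)
    show "\<bar>1 - ?\<Gamma> x - 2 * q\<bar> \<le> 2 + 2 * \<bar>q\<bar>" for x using \<Gamma>[of x] by linarith
  qed (use c in simp)
  then have "a * ((max 0 (1 - measure_pmf.expectation (bind_pmf init (trans (t - h))) overflow - 2 * q))\<^sup>2 / V) \<le>
      a * (measure_pmf.expectation \<nu> (\<lambda>x. (max 0 (1 - ?\<Gamma> x - 2 * q))\<^sup>2) / V)"
    using a V by (intro mult_left_mono divide_right_mono) auto
  also have "\<dots> = measure_pmf.expectation \<nu> (\<lambda>x. a * ((max 0 (1 - ?\<Gamma> x - 2 * q))\<^sup>2 / V))"
    by simp
  also have "\<dots> \<le> measure_pmf.expectation \<nu> (\<lambda>x. \<Sum>i\<in>UNIV. ?D i x)"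
  proof (rule integral_mono)
    fix x
    have "a * ((max 0 (1 - ?\<Gamma> x - 2 * q))\<^sup>2 / V) \<le> a * (\<Sum>i\<in>UNIV. ?S i x)"
      unfolding V_def by (intro mult_left_mono sum_forecast_square_ge r R far q a)
    also have "\<dots> = (\<Sum>i\<in>UNIV. a * ?S i x)" by (rule sum_distrib_left)
    also have "\<dots> \<le> (\<Sum>i\<in>UNIV. ?D i x)"
      unfolding a_def forecast_add[OF r h]
      by (intro sum_mono variance_trans_ge[OF h]) (rule abs_forecast_le)
    finally show "a * ((max 0 (1 - ?\<Gamma> x - 2 * q))\<^sup>2 / V) \<le> (\<Sum>i\<in>UNIV. ?D i x)" .
  next
    have "\<bar>(max 0 (1 - ?\<Gamma> x - 2 * q))\<^sup>2\<bar> \<le> (2 + 2 * \<bar>q\<bar>)\<^sup>2" for x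
    proof -
      have "max 0 (1 - ?\<Gamma> x - 2 * q) \<le> 2 + 2 * \<bar>q\<bar>" using \<Gamma>[of x] by linarith
      from power_mono[OF this, of 2] show ?thesis by simp
    qed
    then have "integrable \<nu> (\<lambda>x. (max 0 (1 - ?\<Gamma> x - 2 * q))\<^sup>2)" by (rule integrable_pmf_bounded)
    then show "integrable \<nu> (\<lambda>x. a * ((max 0 (1 - ?\<Gamma> x - 2 * q))\<^sup>2 / V))"
      by (intro integrable_mult_right integrable_divide_zero) auto
    show "integrable \<nu> (\<lambda>x. \<Sum>i\<in>UNIV. ?D i x)" using intD by (rule Bochner_Integration.integrable_sum)
  qed
  also have "\<dots> = (\<Sum>i\<in>UNIV. measure_pmf.expectation \<nu> (?D i))"
    using intD by (rule Bochner_Integration.integral_sum)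
  also have "\<dots> = energy init t r - energy init t (r + h)"
  proof -
    have "measure_pmf.expectation \<nu> (?D i) =
        measure_pmf.expectation (bind_pmf init (trans (t - r))) (\<lambda>x. (forecast r i x)\<^sup>2) -
        measure_pmf.expectation \<nu> (\<lambda>x. (forecast (r + h) i x)\<^sup>2)" for i
    proof -
      have "bind_pmf init (trans (t - r)) = bind_pmf \<nu> (trans h)"
        using step[OF h] by (simp add: algebra_simps)
      then show ?thesis
        by (simp add: expectation_bind_pmf[OF forecast_square_le] integrable_pmf_bounded[OF forecast_square_le]
            integrable_pmf_bounded[OF abs_expectation_le[OF forecast_square_le]])
    qed
    then show ?thesis by (simp add: energy_def \<nu>_def sum_subtractf)
  qed
  finally show ?thesis by (simp add: a_def V_def mult_ac)
qed

text \<open>With no ring in the last \<open>h\<close> time units, which has probability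
  \<open>exp (- (card E * h))\<close>, an overflow at time \<open>t - h\<close> persists until
  \<open>t\<close>; the complementary probability is the error.\<close>

lemma overflow_expectation_le:
  assumes "0 \<le> h" "h \<le> t"
  shows "measure_pmf.expectation (bind_pmf init (trans (t - h))) overflow \<le>
    measure_pmf.expectation (bind_pmf init (trans t)) overflow + (1 - exp (- (real (card E) * h)))"
proof -
  define \<nu> where "\<nu> = bind_pmf init (trans (t - h))"
  define b where "b = exp (- (real (card E) * h))"
  have b: "0 < b" "b \<le> 1" using assms by (auto simp: b_def)
  have \<nu>: "bind_pmf \<nu> (trans h) = bind_pmf init (trans t)"
    using trans_add[of "t - h" h] assms by (simp add: \<nu>_def bind_assoc_pmf)
  have ge: "b * overflow x \<le> measure_pmf.expectation (trans h x) overflow" for x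
  proof -
    have "0 \<le> measure_pmf.expectation (recv x) (\<lambda>w. overflow (add_ball x w))"
      by (rule integral_nonneg_AE) (simp add: overflow_def)
    then have "b * overflow x \<le> b * (overflow x + real (card E) * h *
        measure_pmf.expectation (recv x) (\<lambda>w. overflow (add_ball x w)))"
      using assms b by (intro mult_left_mono) auto
    also have "\<dots> \<le> measure_pmf.expectation (trans h x) overflow"
      unfolding b_def by (rule expectation_trans_ge[OF assms(1), where B=1]) (auto simp: overflow_def)
    finally show ?thesis .
  qed
  have "b * measure_pmf.expectation \<nu> overflow = measure_pmf.expectation \<nu> (\<lambda>x. b * overflow x)" by simp
  also have "\<dots> \<le> measure_pmf.expectation \<nu> (\<lambda>x. measure_pmf.expectation (trans h x) overflow)"
    using ge by (intro integral_mono integrable_mult_right integrable_pmf_bounded[OF abs_overflow_le]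
        integrable_pmf_bounded[OF abs_expectation_le[OF abs_overflow_le]])
  also have "\<dots> = measure_pmf.expectation (bind_pmf init (trans t)) overflow"
    unfolding \<nu>[symmetric] by (rule expectation_bind_pmf[OF abs_overflow_le, symmetric])
  finally have "b * measure_pmf.expectation \<nu> overflow \<le>
    measure_pmf.expectation (bind_pmf init (trans t)) overflow" .
  moreover have "(1 - b) * measure_pmf.expectation \<nu> overflow \<le> (1 - b) * 1"
    using b abs_expectation_le[where p=\<nu> and f=overflow, OF abs_overflow_le] by (intro mult_left_mono) auto
  ultimately show ?thesis by (simp add: \<nu>_def b_def algebra_simps)
qed

end

text \<open>On arguments up to \<open>1\<close> the function \<open>[u]_+^2\<close> has Lipschitz
  constant \<open>2\<close>.\<close>

lemma square_pos_part_diff_ge: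
  fixes u \<delta> :: real
  assumes "u \<le> 1" "0 \<le> \<delta>"
  shows "(max 0 u)\<^sup>2 - 2 * \<delta> \<le> (max 0 (u - \<delta>))\<^sup>2"
proof (cases "\<delta> \<le> u")
  case True
  have "\<delta> * u \<le> \<delta> * 1" using assms by (intro mult_left_mono)
  moreover have "(u - \<delta>)\<^sup>2 = u\<^sup>2 - 2 * (\<delta> * u) + \<delta>\<^sup>2" by (simp add: power2_diff)
  moreover have "max 0 u = u" "max 0 (u - \<delta>) = u - \<delta>" using True assms by auto
  ultimately show ?thesis using zero_le_power2[of \<delta>] by (simp only:)
next
  case False
  show ?thesis
  proof (cases "0 \<le> u")
    case True
    have "u * u \<le> 1 * \<delta>" using True False assms by (intro mult_mono) auto
    then show ?thesis using True False assms by (simp add: power2_eq_square)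
  qed (use assms in simp)
qed

section \<open>From short steps to the time integral\<close>

context paired_rule
begin

text \<open>Stated for any integrable minorant \<open>\<phi>\<close> of the loss rate, so that the
  general bound and its special case can each supply an integrand of their own.\<close>

lemma integral_loss_rate_le:
  assumes T: "0 \<le> T" "T \<le> t"
    and R: "\<And>s. s \<in> {0..T} \<Longrightarrow> 0 < R s" and far: "\<And>s i. s \<in> {0..T} \<Longrightarrow> d i (\<psi> i) \<ge> 2 * R s"
    and q: "\<And>s x. s \<in> {0..T} \<Longrightarrow>
      \<P>((J\<^sub>0, \<omega>) in palm_space E ori thr x. d (tag E ori thr s x J\<^sub>0 \<omega>) J\<^sub>0 \<ge> R s) \<le> q s"
    and p: "p = measure_pmf.expectation (bind_pmf init (trans t)) overflow"
    and \<phi>: "\<phi> integrable_on {0..T}"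
    and le: "\<And>s. s \<in> {0..T} \<Longrightarrow> \<phi> s \<le> (max 0 (1 - p - 2 * q s))\<^sup>2 / max_ball_card d (R s)"
  shows "real (card E) * integral {0..T} \<phi> \<le> CARD('v) * M\<^sup>2"
proof -
  let ?m = "real (card E)"
  have p0: "0 \<le> p" unfolding p by (rule integral_nonneg_AE) (simp add: overflow_def)
  note dec = energy_decrement[where init=init and t=t, OF _ _ _ R far q]
  have "?m * integral {0..T} \<phi> \<le> energy init t 0"
  proof (rule integral_loss_le[OF T(1) _ energy_nonneg \<phi>, where
        a="\<lambda>h. ?m * exp (- (2 * ?m * h))" and \<epsilon>="\<lambda>h. 2 * (1 - exp (- (?m * h)))"])
    show "antimono_on {0..T} (energy init t)"
    proof (rule monotone_onI)
      fix r r' assume r: "r \<in> {0..T}" "r' \<in> {0..T}" "r \<le> r'"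
      \<comment> \<open>The lower bound on a decrement is nonnegative, so monotonicity is a
        by-product of it.\<close>
      have "0 \<le> energy init t r - energy init t (r + (r' - r))"
        by (rule order_trans[OF _ dec[of r "r' - r"]]) (use r T in auto)
      then show "energy init t r' \<le> energy init t r" by simp
    qed
    have "((\<lambda>h. ?m * exp (- (2 * ?m * h))) \<longlongrightarrow> ?m * exp (- (2 * ?m * 0))) (at_right 0)"
      by (intro tendsto_intros)
    then show "((\<lambda>h. ?m * exp (- (2 * ?m * h))) \<longlongrightarrow> ?m) (at_right 0)" by simp
    have "((\<lambda>h. 2 * (1 - exp (- (?m * h)))) \<longlongrightarrow> 2 * (1 - exp (- (?m * 0)))) (at_right 0)"
      by (intro tendsto_intros)
    then show "((\<lambda>h. 2 * (1 - exp (- (?m * h)))) \<longlongrightarrow> 0) (at_right 0)" by simp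
    fix r h assume r: "0 \<le> r" "0 < h" "r + h \<le> T"
    then have rT: "r \<in> {0..T}" by auto
    define V where "V = real (max_ball_card d (R r))"
    have V: "1 \<le> V" using max_ball_card_pos[OF d, of "R r"] R[OF rT] by (simp add: V_def)
    define \<delta> where "\<delta> = 1 - exp (- (?m * h))"
    have \<delta>: "0 \<le> \<delta>" using r by (simp add: \<delta>_def)
    \<comment> \<open>As a bound on a probability \<open>q r\<close> is nonnegative, which keeps
      \<open>1 - p - 2 * q r\<close> at most \<open>1\<close> for the Lipschitz estimate.\<close>
    have "0 \<le> q r" by (rule order_trans[OF measure_nonneg q[OF rT]])
    then have "(max 0 (1 - p - 2 * q r))\<^sup>2 - 2 * \<delta> \<le> (max 0 (1 - p - 2 * q r - \<delta>))\<^sup>2"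
      using p0 \<delta> by (intro square_pos_part_diff_ge) auto
    also have "\<dots> \<le> (max 0 (1 - measure_pmf.expectation (bind_pmf init (trans (t - h))) overflow - 2 * q r))\<^sup>2"
      using overflow_expectation_le[of h t init] r T by (intro power_mono) (auto simp: p \<delta>_def)
    finally have *: "(max 0 (1 - p - 2 * q r))\<^sup>2 - 2 * \<delta> \<le> \<dots>" .
    have "\<phi> r - 2 * \<delta> \<le> (max 0 (1 - p - 2 * q r))\<^sup>2 / V - 2 * \<delta> / V"
    proof -
      \<comment> \<open>A ball contains its centre, so \<open>V\<close> is at least \<open>1\<close>
        and the error term becomes uniform in \<open>r\<close>, as \<open>integral_loss_le\<close>
        demands.\<close>
      have "2 * \<delta> / V \<le> 2 * \<delta>" using V \<delta> by (simp add: divide_le_eq mult_le_cancel_left1)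
      then show ?thesis using le[OF rT] by (simp add: V_def)
    qed
    also have "\<dots> \<le> (max 0 (1 - measure_pmf.expectation (bind_pmf init (trans (t - h))) overflow - 2 * q r))\<^sup>2 / V"
      unfolding diff_divide_distrib[symmetric] using * V by (intro divide_right_mono) auto
    finally have "h * (?m * exp (- (2 * ?m * h))) * (\<phi> r - 2 * \<delta>) \<le> h * (?m * exp (- (2 * ?m * h))) * \<dots>"
      using r by (intro mult_left_mono) auto
    also have "\<dots> \<le> energy init t r - energy init t (r + h)"
      unfolding V_def by (rule dec) (use r T in auto)
    finally show "h * (?m * exp (- (2 * ?m * h))) * (\<phi> r - 2 * (1 - exp (- (?m * h)))) \<le>
        energy init t r - energy init t (r + h)" unfolding \<delta>_def .
  qed
  also have "\<dots> \<le> CARD('v) * M\<^sup>2" by (rule energy_le)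
  finally show ?thesis .
qed

end

theorem theorem5p2:
  fixes E :: "'v::finite set set"
    and ori :: "'v set \<Rightarrow> 'v \<times> 'v"
    and thr :: "'v set \<Rightarrow> int \<Rightarrow> real"
    and init :: "('v \<Rightarrow> int) pmf"
    and d :: "'v \<Rightarrow> 'v \<Rightarrow> real"
    and \<psi> :: "'v \<Rightarrow> 'v"
    and T t M p :: real
    and R q :: "real \<Rightarrow> real"
    and N m :: nat
  assumes "simple_graph E"
    and "N = CARD('v)" and "N \<ge> 2"
    and "m = card E" and "m \<ge> 1"
    and "endpoint_local_monotone_rule E ori thr"
    and "pseudometric d"
    and "bij \<psi>"
    and "0 \<le> T" and "T \<le> t" and "M \<ge> 1"
    and "\<And>s. s \<in> {0..T} \<Longrightarrow> R s > 0"
    and "\<And>s i. s \<in> {0..T} \<Longrightarrow> d i (\<psi> i) \<ge> 2 * R s"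
    and "\<And>s x. s \<in> {0..T} \<Longrightarrow>
           \<P>((J\<^sub>0, \<omega>) in palm_space E ori thr x. d (tag E ori thr s x J\<^sub>0 \<omega>) J\<^sub>0 \<ge> R s) \<le> q s"
    and "p = \<P>((x, \<omega>) in process_space E init. of_int (gap (load E ori thr t x \<omega>)) > M - 1)"
  shows "M\<^sup>2 \<ge> real m / real N *
             integral {0..T} (\<lambda>s. (max 0 (1 - p - 2 * q s))\<^sup>2 / real (max_ball_card d (R s))) \<and>
         (p \<le> 1/8 \<and> (\<forall>s\<in>{0..T}. q s \<le> 1/8) \<longrightarrow>
           M\<^sup>2 \<ge> real m / (4 * real N) *
             integral {0..T} (\<lambda>s. 1 / real (max_ball_card d (R s))))"
proof -
  interpret paired_rule E ori thr d \<psi> M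
    using assms by unfold_locales auto
  have "overflow = (\<lambda>y. of_bool (of_int (gap y) > M - 1))" by (simp add: overflow_def fun_eq_iff)
  then have p: "p = measure_pmf.expectation (bind_pmf init (trans t)) overflow"
    using prob_process[of t init "\<lambda>y. of_int (gap y) > M - 1"] assms by simp
  note bound = integral_loss_rate_le[where R=R and q=q, OF assms(9,10,12-14) p]
  let ?\<phi> = "\<lambda>s. (max 0 (1 - p - 2 * q s))\<^sup>2 / real (max_ball_card d (R s))"
  have N: "0 < real N" using assms by simp
  show ?thesis
  proof (intro conjI impI)
    show "real m / real N * integral {0..T} ?\<phi> \<le> M\<^sup>2"
    \<comment> \<open>The integral of a non-integrable function is \<open>0\<close> by convention,
      and then the bound is trivial.\<close>
    proof (cases "?\<phi> integrable_on {0..T}")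
      case True
      then show ?thesis using bound[OF _ _ _ True] N by (simp add: assms(2,4) divide_le_eq mult.commute)
    qed (simp add: not_integrable_integral)
  next
    assume small: "p \<le> 1/8 \<and> (\<forall>s\<in>{0..T}. q s \<le> 1/8)"
    \<comment> \<open>This integrand gets its own case distinction: \<open>\<phi>\<close> in
      \<open>integral_loss_rate_le\<close> is taken to be a quarter of it, with no appeal to the
      first bound.\<close>
    let ?\<phi> = "\<lambda>s. 1 / real (max_ball_card d (R s))"
    show "real m / (4 * real N) * integral {0..T} ?\<phi> \<le> M\<^sup>2"
    proof (cases "?\<phi> integrable_on {0..T}")
      case True
      have "1 / 4 * ?\<phi> s \<le> (max 0 (1 - p - 2 * q s))\<^sup>2 / real (max_ball_card d (R s))" if s: "s \<in> {0..T}" for s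
      proof -
        \<comment> \<open>The hypotheses give \<open>1 - 1/8 - 2/8 = 5/8\<close>; rounding down to
          \<open>1/2\<close> and squaring yields the factor \<open>1/4\<close>.\<close>
        have "1 / 2 \<le> max 0 (1 - p - 2 * q s)" using small s by force
        from power_mono[OF this, of 2] have "1 / 4 \<le> (max 0 (1 - p - 2 * q s))\<^sup>2"
          by (simp add: power2_eq_square)
        from divide_right_mono[OF this, of "real (max_ball_card d (R s))"] show ?thesis by simp
      qed
      then have "real (card E) * integral {0..T} (\<lambda>s. 1 / 4 * ?\<phi> s) \<le> real CARD('v) * M\<^sup>2"
        by (intro bound integrable_on_mult_right True)
      then have "real m * (1 / 4 * integral {0..T} ?\<phi>) \<le> real N * M\<^sup>2"
        by (simp only: integral_mult_right assms(2,4))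
      then show ?thesis using N by (simp add: divide_le_eq mult_ac)
    qed (simp add: not_integrable_integral)
  qed
qed

end
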